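(* Let $K$ be a quadratic field with discriminant $\Delta_K$, let $d=|\Delta_K|$, and let $\chi$ be the Dirichlet character attached to $K/\mathbb{Q}$. For $\mathrm{Re}(s)>1$ let $$p_1(s)=\prod_{\chi(p)=1}(1-p^{-s})^{-1},\qquad p_2(s)=\prod_{\chi(p)=-1}(1-p^{-s})^{-1},$$ $$q_1(s)=\frac{\zeta(2s)}{\zeta(s)L(s,\chi)}\prod_{p\mid d}(1+p^{-s}),\qquad q_2(s)=\frac{L(s,\chi)}{\zeta(s)}\prod_{p\mid d}(1-p^{-s})^{-1}.$$ Let $s$ be a complex number such that $\mathrm{Re}(s)\ge 1$. Then, as $n\to\infty$, $$p_1(2s)=\exp\left\{-\sum_{k=1}^{n}\frac{1}{2^k}\log q_1(2^ks)\right\}+o\left(2^{-2^n}\right)$$ and $$p_2(2s)=\exp\left\{-\sum_{k=1}^{n}\frac{1}{2^k}\log q_2(2^ks)\right\}+o\left(2^{-2^n}\right).$$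
   Context: The Dirichlet character attached to the quadratic field $K$ is the primitive quadratic character modulo $d=|\Delta_K|$ given by the Kronecker symbol $\chi(n)=\left(\frac{\Delta_K}{n}\right)$; for a prime $p$, $\chi(p)=1,-1,0$ according as $p$ splits, is inert, or ramifies in $K$. $\zeta$ is the Riemann zeta function and $L(s,\chi)$ is the Dirichlet $L$-function of $\chi$. All products are over prime numbers $p$ satisfying the indicated condition. $\log$ denotes the principal branch of the complex logarithm. The notation $a(n)=b(n)+o(g(n))$ means $\lim_{n\to+\infty}\frac{a(n)-b(n)}{g(n)}=0$ (here $s$ is fixed). *)

theory Defs
  imports
    "HOL-Analysis.Analysis"
    "HOL-Number_Theory.Number_Theory"
    "HOL-Library.Landau_Symbols"
begin

definition is_subfield :: "'a::field set \<Rightarrow> bool" where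
  "is_subfield K \<longleftrightarrow> 1 \<in> K \<and> (\<forall>x\<in>K. \<forall>y\<in>K. x - y \<in> K \<and> x * y \<in> K) \<and> (\<forall>x\<in>K. inverse x \<in> K)"

text \<open>
  The prime field of an ambient field of characteristic 0 is the image of \<^const>\<open>of_rat\<close>,
  so a subfield \<open>K\<close> is a rational vector space via \<open>q \<cdot> x = of_rat q * x\<close>. Note that
  \<open>vector_space.dim\<close> is 0 on infinite-dimensional spaces, so that dimension 2 is meant literally.
\<close>

definition quadratic_field :: "'a::field_char_0 set \<Rightarrow> bool" where
  "quadratic_field K \<longleftrightarrow>
     is_subfield K \<and> vector_space.dim (\<lambda>(q::rat) (x::'a). of_rat q * x) K = 2"

definition ring_of_integers :: "'a::field_char_0 set \<Rightarrow> 'a set" where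
  "ring_of_integers K = {x \<in> K. algebraic_int x}"

definition integral_basis2 :: "'a::field_char_0 set \<Rightarrow> 'a \<Rightarrow> 'a \<Rightarrow> bool" where
  "integral_basis2 K b1 b2 \<longleftrightarrow>
     b1 \<in> ring_of_integers K \<and> b2 \<in> ring_of_integers K \<and>
     (\<forall>x\<in>ring_of_integers K. \<exists>!mn::int \<times> int. x = of_int (fst mn) * b1 + of_int (snd mn) * b2)"

definition complex_embedding :: "'a::field_char_0 set \<Rightarrow> ('a \<Rightarrow> complex) \<Rightarrow> bool" where
  "complex_embedding K \<sigma> \<longleftrightarrow>
     \<sigma> 1 = 1 \<and> (\<forall>x\<in>K. \<forall>y\<in>K. \<sigma> (x + y) = \<sigma> x + \<sigma> y \<and> \<sigma> (x * y) = \<sigma> x * \<sigma> y)"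

text \<open>
  The discriminant is the squared determinant of the matrix of the two embeddings evaluated
  at an integral basis; it does not depend on the choice of the basis or on the order of the
  embeddings. Only the values of an embedding on \<open>K\<close> matter, hence two embeddings are different
  if they differ at some point of \<open>K\<close>.
\<close>

definition field_disc :: "'a::field_char_0 set \<Rightarrow> int" where
  "field_disc K = (THE D. \<exists>b1 b2 \<sigma> \<tau>.
     integral_basis2 K b1 b2 \<and> complex_embedding K \<sigma> \<and> complex_embedding K \<tau> \<and>
     (\<exists>x\<in>K. \<sigma> x \<noteq> \<tau> x) \<and>
     of_int D = (\<sigma> b1 * \<tau> b2 - \<sigma> b2 * \<tau> b1)\<^sup>2)"

definition abs_disc :: "'a::field_char_0 set \<Rightarrow> nat" where
  "abs_disc K = nat \<bar>field_disc K\<bar>"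

definition kronecker_prime :: "int \<Rightarrow> nat \<Rightarrow> int" where
  "kronecker_prime a p =
     (if p = 2 then (if even a then 0 else if a mod 8 \<in> {1, 7} then 1 else -1)
      else Legendre a (int p))"

definition kronecker :: "int \<Rightarrow> nat \<Rightarrow> int" where
  "kronecker a n =
     (if n = 0 then (if \<bar>a\<bar> = 1 then 1 else 0)
      else (\<Prod>p\<in>#prime_factorization n. kronecker_prime a p))"

definition field_char :: "'a::field_char_0 set \<Rightarrow> nat \<Rightarrow> int" where
  "field_char K n = kronecker (field_disc K) n"

text \<open>
  All of the following series and infinite products are meant for \<open>Re s > 1\<close>, where they converge
  absolutely. The series start at \<open>1\<close>, whence the shift by \<^const>\<open>Suc\<close>.
\<close>

definition riemann_zeta :: "complex \<Rightarrow> complex" where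
  "riemann_zeta s = (\<Sum>n. of_nat (Suc n) powr (-s))"

definition L_series :: "(nat \<Rightarrow> int) \<Rightarrow> complex \<Rightarrow> complex" where
  "L_series c s = (\<Sum>n. of_int (c (Suc n)) * of_nat (Suc n) powr (-s))"

definition prime_prodinf :: "(nat \<Rightarrow> bool) \<Rightarrow> (nat \<Rightarrow> complex) \<Rightarrow> complex" where
  "prime_prodinf P f = prodinf (\<lambda>p. if prime p \<and> P p then f p else 1)"

definition p1 :: "'a::field_char_0 set \<Rightarrow> complex \<Rightarrow> complex" where
  "p1 K s = prime_prodinf (\<lambda>p. field_char K p = 1) (\<lambda>p. inverse (1 - of_nat p powr (-s)))"

definition p2 :: "'a::field_char_0 set \<Rightarrow> complex \<Rightarrow> complex" where
  "p2 K s = prime_prodinf (\<lambda>p. field_char K p = -1) (\<lambda>p. inverse (1 - of_nat p powr (-s)))"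

definition q1 :: "'a::field_char_0 set \<Rightarrow> complex \<Rightarrow> complex" where
  "q1 K s = riemann_zeta (2 * s) / (riemann_zeta s * L_series (field_char K) s) *
     (\<Prod>p | prime p \<and> p dvd abs_disc K. 1 + of_nat p powr (-s))"

definition q2 :: "'a::field_char_0 set \<Rightarrow> complex \<Rightarrow> complex" where
  "q2 K s = L_series (field_char K) s / riemann_zeta s *
     (\<Prod>p | prime p \<and> p dvd abs_disc K. inverse (1 - of_nat p powr (-s)))"

end

theory Submission
  imports Defs
begin

text \<open>
  Write \<open>p\<^sub>j(s) = exp (\<ell>\<^sub>j(s))\<close> where \<open>\<ell>\<^sub>j(s)\<close> sums \<open>- Ln (1 - p powr (-s))\<close> over the primes with
  \<open>\<chi>(p) = \<plusminus>1\<close>. Comparing Euler factors gives \<open>q\<^sub>j(s) = p\<^sub>j(2s) / p\<^sub>j(s)\<^sup>2\<close>; only complete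
  multiplicativity of \<open>\<chi>\<close> and the finiteness of the set of ramified primes enter, the latter because
  the discriminant is a well-defined nonzero integer. For \<open>Re s \<ge> 2\<close> the number \<open>\<ell>\<^sub>j(2s) - 2 \<ell>\<^sub>j(s)\<close> is so
  small that it equals \<open>Ln (q\<^sub>j(s))\<close>, whence the sum in the exponent telescopes to
  \<open>\<ell>\<^sub>j(2s) - \<ell>\<^sub>j(2\<^sup>n\<^sup>+\<^sup>1 s) / 2\<^sup>n\<close>. The error term is of the order of the square of \<open>2 powr (-2\<^sup>n)\<close>, since the
  prime \<open>2\<close> dominates \<open>\<ell>\<^sub>j\<close>.
\<close>

subsection \<open>Discriminants of quadratic fields\<close>

lemma subfield_closed:
  assumes "is_subfield K"
  shows "0 \<in> K" "1 \<in> K" "x \<in> K \<Longrightarrow> y \<in> K \<Longrightarrow> x - y \<in> K" "x \<in> K \<Longrightarrow> y \<in> K \<Longrightarrow> x * y \<in> K"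
    "x \<in> K \<Longrightarrow> - x \<in> K" "x \<in> K \<Longrightarrow> y \<in> K \<Longrightarrow> x + y \<in> K" "x \<in> K \<Longrightarrow> inverse x \<in> K"
proof -
  have *: "1 \<in> K" "\<And>x y. x \<in> K \<Longrightarrow> y \<in> K \<Longrightarrow> x - y \<in> K"
    "\<And>x y. x \<in> K \<Longrightarrow> y \<in> K \<Longrightarrow> x * y \<in> K" "\<And>x. x \<in> K \<Longrightarrow> inverse x \<in> K"
    using assms unfolding is_subfield_def by blast+
  have 0: "0 \<in> K" using *(2)[OF *(1) *(1)] by simp
  have neg: "- x \<in> K" if "x \<in> K" for x using *(2)[OF 0 that] by simp
  have "x + y \<in> K" if "x \<in> K" "y \<in> K" for x y using *(2)[OF that(1) neg[OF that(2)]] by simp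
  then show "0 \<in> K" "1 \<in> K" "x \<in> K \<Longrightarrow> y \<in> K \<Longrightarrow> x - y \<in> K" "x \<in> K \<Longrightarrow> y \<in> K \<Longrightarrow> x * y \<in> K"
    "x \<in> K \<Longrightarrow> - x \<in> K" "x \<in> K \<Longrightarrow> y \<in> K \<Longrightarrow> x + y \<in> K" "x \<in> K \<Longrightarrow> inverse x \<in> K"
    by (simp_all add: * 0 neg)
qed

lemma subfield_of_rat:
  fixes K :: "'a::field_char_0 set"
  assumes "is_subfield K"
  shows "of_rat q \<in> K"
proof -
  have nat: "of_nat n \<in> K" for n
    by (induction n) (use subfield_closed[OF assms] in auto)
  have int: "of_int n \<in> K" for n
    by (cases n) (use nat subfield_closed[OF assms] in \<open>auto simp del: of_nat_Suc\<close>)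
  obtain a b where "quotient_of q = (a, b)" by force
  then have "q = of_int a / of_int b" by (rule quotient_of_div)
  then have "of_rat q = of_int a * inverse (of_int b :: 'a)" by (simp add: of_rat_divide divide_inverse of_rat_mult of_rat_inverse)
  then show ?thesis using int subfield_closed[OF assms] by simp
qed

text \<open>A second representation would exhibit \<open>x\<close> as a quotient of rationals. This
  is the uniqueness of coordinates in a quadratic field.\<close>

lemma irrational_combination_eq_iff:
  fixes x :: "'a::field_char_0"
  assumes "x \<notin> \<rat>"
  shows "of_rat u + of_rat v * x = of_rat u' + of_rat v' * x \<longleftrightarrow> u = u' \<and> v = v'"
proof
  assume eq: "of_rat u + of_rat v * x = of_rat u' + of_rat v' * x"
  have "v = v'"
  proof (rule ccontr)
    assume "v \<noteq> v'"
    then have "of_rat (v - v') \<noteq> (0::'a)" by simp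
    moreover have "of_rat (v - v') * x = of_rat (u' - u)"
      using eq by (simp add: of_rat_diff algebra_simps)
    ultimately have "x = of_rat ((u' - u) / (v - v'))"
      by (simp add: of_rat_divide field_simps)
    with assms show False by simp
  qed
  with eq show "u = u' \<and> v = v'" by simp
qed simp

lemma irrational_int_combination_eq_iff:
  fixes x :: "'a::field_char_0"
  assumes "x \<notin> \<rat>"
  shows "of_int p + of_int q * x = of_int p' + of_int q' * x \<longleftrightarrow> p = p' \<and> q = q'"
  using irrational_combination_eq_iff[OF assms, of "of_int p" "of_int q" "of_int p'" "of_int q'"] by simp

section \<open>Integrality of trace and norm\<close>

text \<open>This is Gauss's lemma in degree 2. Clearing denominators in X^2 - t X + \<nu> and taking
  the primitive part gives \<open>F\<close>; a monic integer polynomial \<open>P\<close> vanishing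
  at \<open>x\<close> is, up to a constant, a multiple of \<open>F\<close>. Comparing contents makes
  the leading coefficient of \<open>F\<close> a unit, so the denominators cancel.\<close>

lemma quadratic_algebraic_intD:
  fixes x :: "'a::field_char_0"
  assumes irr: "x \<notin> \<rat>" and x: "x * x = of_rat t * x - of_rat \<nu>" and int: "algebraic_int x"
  shows "t \<in> \<int>" "\<nu> \<in> \<int>"
proof -
  obtain a1 c1 where 1: "quotient_of t = (a1, c1)" by force
  obtain b1 e1 where 2: "quotient_of \<nu> = (b1, e1)" by force
  define a where "a = a1 * e1"
  define b where "b = b1 * c1"
  define c where "c = c1 * e1"
  have pos: "c1 > 0" "e1 > 0" using 1 2 by (auto dest: quotient_of_denom_pos)
  then have c: "c \<noteq> 0" by (auto simp: c_def)
  have t: "t = of_int a / of_int c" and \<nu>: "\<nu> = of_int b / of_int c"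
    using quotient_of_div[OF 1] quotient_of_div[OF 2] pos by (auto simp: a_def b_def c_def)
  define F0 where "F0 = [:b, - a, c:]"
  define F where "F = primitive_part F0"
  have F0: "F0 = Polynomial.smult (content F0) F" by (simp add: F_def)
  have "F0 \<noteq> 0" using c by (simp add: F0_def)
  then have k0: "content F0 \<noteq> 0" by simp
  have cF: "content F = 1" using \<open>F0 \<noteq> 0\<close> by (simp add: F_def)
  have degF0: "degree F0 = 2" using c by (simp add: F0_def)
  then have degF: "degree F = 2" using F0 k0 by (metis degree_smult_eq)
  have "poly (map_poly of_int F0) x = of_int b - of_int a * x + of_int c * (x * x)"
    by (simp add: F0_def map_poly_pCons algebra_simps)
  also have "\<dots> = 0" using c unfolding x t \<nu> by (simp add: of_rat_divide field_simps)
  finally have "of_int (content F0) * poly (map_poly of_int F) x = 0"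
    by (subst (asm) F0) (simp add: map_poly_smult)
  then have Fx: "poly (map_poly of_int F) x = 0" using k0 by simp
  obtain P where P: "poly (map_poly of_int P) x = 0" "lead_coeff P = 1"
    using int algebraic_int_altdef_ipoly by blast
  \<comment> \<open>Pseudo-division keeps the coefficients integral at the cost of the factor
    \<open>h\<close>. The remainder vanishes at \<open>x\<close> and has degree below 2, so
    irrationality of \<open>x\<close> forces it to be zero.\<close>
  define r where "r = pseudo_mod P F"
  have "F \<noteq> 0" using degF by auto
  from pseudo_mod[OF this, of P] obtain h q where hq: "h \<noteq> 0" "Polynomial.smult h P = F * q + r"
    and r: "r = 0 \<or> degree r < 2" unfolding r_def degF by blast
  have "poly (map_poly of_int (Polynomial.smult h P)) x = (0::'a)" using P by (simp add: map_poly_smult)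
  moreover have hom: "map_poly of_int (F * q + r) = map_poly of_int F * map_poly of_int q + (map_poly of_int r :: 'a poly)"
    by (intro poly_eqI) (simp add: coeff_map_poly coeff_mult)
  ultimately have rx: "poly (map_poly of_int r) x = 0" using hq(2) Fx by simp
  have "r = 0"
  proof -
    have re: "r = [:Polynomial.coeff r 0, Polynomial.coeff r 1:]"
    proof (rule poly_eqI)
      fix n show "Polynomial.coeff r n = Polynomial.coeff [:Polynomial.coeff r 0, Polynomial.coeff r 1:] n"
      proof (cases "n < 2")
        case True then have "n = 0 \<or> n = 1" by auto
        then show ?thesis by auto
      next
        case False
        then have "Polynomial.coeff r n = 0" using r by (auto intro: coeff_eq_0)
        moreover obtain m where "n = Suc (Suc m)" using False by (metis add_2_eq_Suc le_add_diff_inverse not_less)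
        ultimately show ?thesis by simp
      qed
    qed
    have "of_int (Polynomial.coeff r 0) + of_int (Polynomial.coeff r 1) * x = 0"
      using rx by (subst (asm) re) (simp add: map_poly_pCons algebra_simps)
    then have "of_rat (of_int (Polynomial.coeff r 0)) + of_rat (of_int (Polynomial.coeff r 1)) * x = of_rat 0 + of_rat 0 * x" by simp
    then have "Polynomial.coeff r 0 = 0 \<and> Polynomial.coeff r 1 = 0"
      unfolding irrational_combination_eq_iff[OF irr] by simp
    then show ?thesis by (subst re) simp
  qed
  then have eq: "Polynomial.smult h P = F * q" using hq by simp
  have "content P dvd 1" using P(2) by (metis content_dvd_coeff)
  then have "content P = 1" by (metis is_unit_normalize normalize_content)
  \<comment> \<open>Contents are multiplicative and both \<open>P\<close> and \<open>F\<close> have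
    content 1, so \<open>h\<close> is absorbed by \<open>q\<close> and in particular divides its
    leading coefficient.\<close>
  then have cq: "content q = \<bar>h\<bar>" using arg_cong[OF eq, of content] cF by (simp add: content_mult)
  then obtain w where w: "lead_coeff q = h * w" by (metis abs_dvd_iff content_dvd_coeff dvdE)
  have "h = lead_coeff F * (h * w)"
    using arg_cong[OF eq, of lead_coeff] P(2) w hq(1) by (simp add: lead_coeff_mult)
  then have "lead_coeff F dvd 1" using hq(1) by (metis dvd_triv_left mult.left_commute mult_cancel_left1 mult.commute)
  \<comment> \<open>As the leading coefficient of \<open>F\<close> is a unit, \<open>c\<close>
    divides the content of \<open>F0\<close> and hence the other coefficients \<open>a\<close> and
    \<open>b\<close>.\<close>
  moreover have "c = content F0 * lead_coeff F"
    using F0 degF0 degF by (metis F0_def coeff_pCons_Suc coeff_pCons_0 coeff_smult numeral_2_eq_2)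
  ultimately have cd: "c dvd content F0"
    by (metis dvd_refl mult.commute mult_dvd_mono mult_1)
  have "content F0 dvd Polynomial.coeff F0 0" "content F0 dvd Polynomial.coeff F0 1" by (rule content_dvd_coeff)+
  with cd have "c dvd b" "c dvd a" by (auto simp: F0_def intro: dvd_trans)
  then show "t \<in> \<int>" "\<nu> \<in> \<int>" using c by (auto simp: t \<nu> elim!: dvdE)
qed

lemma quadratic_algebraic_intI:
  fixes x :: "'a::field_char_0"
  assumes "x * x = of_int t * x - of_int n"
  shows "algebraic_int x"
proof -
  have "poly (map_poly of_int [:n, - t, 1:]) x = 0"
    using assms by (simp add: map_poly_pCons algebra_simps)
  moreover have "lead_coeff [:n, - t, 1:] = 1" by simp
  ultimately show ?thesis using algebraic_int_altdef_ipoly by blast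
qed

lemma vector_space_of_rat: "vector_space (\<lambda>(q::rat) (x::'a::field_char_0). of_rat q * x)"
  by unfold_locales (simp_all add: of_rat_add of_rat_mult algebra_simps)

section \<open>Generators and integral bases of quadratic fields\<close>

text \<open>Any irrational element of \<open>K\<close> will do: it is independent of 1, and an
  element outside the span of the two would give three independent vectors in dimension 2.\<close>

lemma quadratic_field_generator:
  fixes K :: "'a::field_char_0 set"
  assumes "quadratic_field K"
  obtains \<alpha> where "\<alpha> \<in> K" "\<alpha> \<notin> \<rat>" "\<And>x. x \<in> K \<Longrightarrow> \<exists>u v. x = of_rat u + of_rat v * \<alpha>"
proof -
  interpret V: vector_space "\<lambda>(q::rat) (x::'a). of_rat q * x" by (rule vector_space_of_rat)
  have K: "is_subfield K" and dim: "V.dim K = 2" using assms by (auto simp: quadratic_field_def)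
  have span1: "V.span {1} = \<rat>"
    by (auto simp: V.span_singleton Rats_def)
  have "\<not> K \<subseteq> \<rat>"
  proof
    assume "K \<subseteq> \<rat>"
    then have "V.dim K \<le> card {1::'a}" by (intro V.dim_le_card) (simp_all add: span1)
    with dim show False by simp
  qed
  then obtain \<alpha> where \<alpha>: "\<alpha> \<in> K" "\<alpha> \<notin> \<rat>" by blast
  have ne: "\<alpha> \<noteq> 1" using \<alpha> by auto
  obtain B where B: "B \<subseteq> K" "V.independent B" "K \<subseteq> V.span B" "card B = V.dim K"
    by (rule V.basis_exists)
  \<comment> \<open>Infinite sets have cardinality 0 by convention, so \<open>card B = 2\<close>
    implies finiteness.\<close>
  have fin: "finite B" using B dim by (intro card_ge_0_finite) simp
  have ind: "V.independent {\<alpha>, 1}"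
    using \<alpha> span1 by (simp add: V.independent_insert)
  have "K \<subseteq> V.span {\<alpha>, 1}"
  proof
    fix x assume x: "x \<in> K"
    show "x \<in> V.span {\<alpha>, 1}"
    proof (rule ccontr)
      assume nx: "x \<notin> V.span {\<alpha>, 1}"
      then have "V.independent {x, \<alpha>, 1}" using ind V.independent_insertI by blast
      moreover have "{x, \<alpha>, 1} \<subseteq> V.span B" using B(3) x \<alpha> subfield_closed[OF K] by auto
      ultimately have "card {x, \<alpha>, 1} \<le> 2" using V.independent_span_bound[OF fin] B(4) dim by metis
      moreover have "x \<noteq> \<alpha>" "x \<noteq> 1" using nx V.span_base by blast+
      ultimately show False using ne by simp
    qed
  qed
  have "\<exists>u v. x = of_rat u + of_rat v * \<alpha>" if "x \<in> K" for x
    proof -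
    have "x \<in> V.span {\<alpha>, 1}" using \<open>K \<subseteq> V.span {\<alpha>, 1}\<close> that by blast
    then obtain v where "x - of_rat v * \<alpha> \<in> \<rat>" unfolding V.span_insert[of \<alpha>] span1 by blast
    then obtain u where "x - of_rat v * \<alpha> = of_rat u" by (auto elim: Rats_cases)
    then have "x = of_rat u + of_rat v * \<alpha>" by (simp add: algebra_simps)
    then show ?thesis by blast
  qed
  with \<alpha> show ?thesis using that by blast
qed

text \<open>Completing the square for a generator and clearing denominators gives an irrational
  element with integral square \<open>m\<close>. Choosing one with least absolute value of
  \<open>m\<close> makes \<open>m\<close> squarefree, since a factor \<open>d * d\<close> could be
  removed by passing to \<open>\<gamma> / of_int d\<close>.\<close>

lemma quadratic_field_sqrt_generator:
  fixes K :: "'a::field_char_0 set"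
  assumes "quadratic_field K"
  obtains \<gamma> m where "\<gamma> \<in> K" "\<gamma> \<notin> \<rat>" "\<gamma> * \<gamma> = of_int m" "\<And>d. d * d dvd m \<Longrightarrow> d dvd 1"
    "\<And>x. x \<in> K \<Longrightarrow> \<exists>u v. x = of_rat u + of_rat v * \<gamma>"
proof -
  have K: "is_subfield K" using assms by (auto simp: quadratic_field_def)
  note closed = subfield_closed[OF K] subfield_of_rat[OF K]
  obtain \<alpha> where \<alpha>: "\<alpha> \<in> K" "\<alpha> \<notin> \<rat>" and gen: "\<And>x. x \<in> K \<Longrightarrow> \<exists>u v. x = of_rat u + of_rat v * \<alpha>"
    using quadratic_field_generator[OF assms] by blast
  have "\<alpha> * \<alpha> \<in> K" by (intro closed(4) \<alpha>(1))
  then obtain a b where ab: "\<alpha> * \<alpha> = of_rat b + of_rat a * \<alpha>" using gen by blast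
  \<comment> \<open>\<open>4 * b + a * a\<close> is the discriminant of the quadratic equation of
    \<open>\<alpha>\<close>, that is, the square of \<open>2 * \<alpha> - of_rat a\<close>. Scaling
    this element by the denominator \<open>e\<close> turns its square into the integer
    \<open>e * r\<close>.\<close>
  obtain r e where "quotient_of (4 * b + a * a) = (r, e)" by force
  then have e: "e > 0" and re: "4 * b + a * a = of_int r / of_int e"
    by (auto dest: quotient_of_denom_pos quotient_of_div)
  define \<gamma>0 where "\<gamma>0 = of_rat (of_int e) * (2 * \<alpha> - of_rat a)"
  define P where "P = (\<lambda>(\<gamma>, m). \<gamma> \<in> K \<and> \<gamma> \<notin> \<rat> \<and> \<gamma> * \<gamma> = of_int m)"
  have "(2 * \<alpha> - of_rat a) * (2 * \<alpha> - of_rat a) = 4 * (\<alpha> * \<alpha>) - 4 * of_rat a * \<alpha> + of_rat a * of_rat a"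
    by (simp add: algebra_simps)
  also have "\<dots> = of_rat (4 * b + a * a)" unfolding ab by (simp add: of_rat_mult of_rat_add algebra_simps)
  finally have "\<gamma>0 * \<gamma>0 = of_rat (of_int e * of_int e * (4 * b + a * a))"
    unfolding \<gamma>0_def by (simp add: of_rat_mult mult_ac)
  also have "\<dots> = of_int (e * r)" unfolding re using e by (simp add: of_rat_mult of_rat_divide)
  finally have sq: "\<gamma>0 * \<gamma>0 = of_int (e * r)" .
  have "2 * \<alpha> = \<alpha> + \<alpha>" by simp
  then have "\<gamma>0 \<in> K" unfolding \<gamma>0_def using \<alpha> closed by metis
  moreover have "\<gamma>0 \<notin> \<rat>"
  proof
    assume "\<gamma>0 \<in> \<rat>"
    moreover have "\<alpha> = (\<gamma>0 / of_int e + of_rat a) / 2" using e by (simp add: \<gamma>0_def)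
    ultimately have "\<alpha> \<in> \<rat>" by (simp only: Rats_divide Rats_add Rats_of_int Rats_of_rat Rats_number_of)
    with \<alpha> show False by simp
  qed
  ultimately have "P (\<gamma>0, e * r)" using sq by (simp add: P_def)
  from ex_has_least_nat[of P, OF this, of "\<lambda>(_, m). nat \<bar>m\<bar>"]
  obtain \<gamma> m where P: "P (\<gamma>, m)" and least: "\<And>\<gamma>' m'. P (\<gamma>', m') \<Longrightarrow> nat \<bar>m\<bar> \<le> nat \<bar>m'\<bar>"
    by (auto simp del: nat_le_iff)
  have \<gamma>: "\<gamma> \<in> K" "\<gamma> \<notin> \<rat>" "\<gamma> * \<gamma> = of_int m" using P by (auto simp: P_def)
  have "\<gamma> \<noteq> 0" using \<gamma> by auto
  then have m0: "m \<noteq> 0" using \<gamma>(3) by auto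
  have sqf: "d dvd 1" if "d * d dvd m" for d
  proof (rule ccontr)
    assume d: "\<not> d dvd 1"
    from that obtain f where f: "m = d * d * f" by blast
    then have "d \<noteq> 0" "f \<noteq> 0" using m0 by auto
    have "P (\<gamma> / of_int d, f)"
    proof -
      have "of_rat (inverse (of_int d)) * \<gamma> \<in> K" by (intro closed(4,8) \<gamma>(1))
      then have "\<gamma> / of_int d \<in> K" by (simp only: of_rat_inverse of_rat_of_int_eq divide_inverse mult.commute)
      moreover have "\<gamma> / of_int d \<notin> \<rat>"
      proof
        assume "\<gamma> / of_int d \<in> \<rat>"
        then have "\<gamma> / of_int d * of_int d \<in> \<rat>" by (intro Rats_mult) auto
        with \<gamma> \<open>d \<noteq> 0\<close> show False by simp
      qed
      moreover have "\<gamma> / of_int d * (\<gamma> / of_int d) = of_int f"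
        using \<gamma>(3) f \<open>d \<noteq> 0\<close> by (simp add: field_simps)
      ultimately show ?thesis by (simp add: P_def)
    qed
    from least[OF this] have "\<bar>d\<bar> * \<bar>d\<bar> * \<bar>f\<bar> \<le> \<bar>f\<bar>" using f by (simp add: abs_mult)
    moreover have "\<bar>d\<bar> \<ge> 2" using d \<open>d \<noteq> 0\<close> by (auto simp: abs_if split: if_splits)
    then have "\<bar>d\<bar> * \<bar>d\<bar> \<ge> 2 * 2" by (intro mult_mono) auto
    then have "2 * 2 * \<bar>f\<bar> \<le> \<bar>d\<bar> * \<bar>d\<bar> * \<bar>f\<bar>" by (intro mult_right_mono) auto
    ultimately show False using \<open>f \<noteq> 0\<close> by simp
  qed
  obtain u0 v0 where uv: "\<gamma> = of_rat u0 + of_rat v0 * \<alpha>" using gen \<gamma> by blast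
  then have "v0 \<noteq> 0" using \<gamma>(2) by auto
  then have \<alpha>_eq: "\<alpha> = of_rat (- u0 / v0) + of_rat (1 / v0) * \<gamma>"
    unfolding uv by (simp add: of_rat_divide of_rat_minus field_simps)
  have "\<exists>u v. x = of_rat u + of_rat v * \<gamma>" if "x \<in> K" for x
  proof -
    from gen[OF that] obtain u v where "x = of_rat u + of_rat v * \<alpha>" by blast
    then have "x = of_rat (u + v * (- u0 / v0)) + of_rat (v * (1 / v0)) * \<gamma>"
      by (subst (asm) \<alpha>_eq) (simp only: of_rat_add of_rat_mult algebra_simps)
    then show ?thesis by blast
  qed
  with \<gamma> sqf show ?thesis using that by blast
qed

text \<open>For irrational \<open>x\<close> the trace \<open>2 * u\<close> and the norm
  \<open>u * u - of_int m * (v * v)\<close> are integers. Hence \<open>m\<close> times the square of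
  \<open>2 * v\<close> is an integer, and as \<open>m\<close> is squarefree the denominator of
  \<open>2 * v\<close> must be 1.\<close>

lemma algebraic_int_sqrt_coordinates:
  fixes \<gamma> :: "'a::field_char_0"
  assumes \<gamma>: "\<gamma> \<notin> \<rat>" "\<gamma> * \<gamma> = of_int m" and sqf: "\<And>d. d * d dvd m \<Longrightarrow> d dvd 1"
    and x: "x = of_rat u + of_rat v * \<gamma>" "algebraic_int x"
  obtains A B where "2 * x = of_int A + of_int B * \<gamma>" "(A * A - m * (B * B)) mod 4 = 0"
proof (cases "v = 0")
  case True
  then have "of_rat u \<in> (\<int> :: 'a set)" using x rational_algebraic_int_is_int by force
  then obtain k where "of_rat u = (of_int k :: 'a)" by (auto elim: Ints_cases)
  then show ?thesis using True x that[of "2 * k" 0] by simp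
next
  case False
  have irr: "x \<notin> \<rat>"
  proof
    assume "x \<in> \<rat>"
    then obtain q where "x = of_rat q" by (auto elim: Rats_cases)
    then have "of_rat u + of_rat v * \<gamma> = of_rat q + of_rat 0 * \<gamma>" using x by simp
    with False show False unfolding irrational_combination_eq_iff[OF \<gamma>(1)] by simp
  qed
  have "x * x = of_rat (2 * u) * x - of_rat (u * u - of_int m * (v * v))"
    using x(1) \<gamma>(2) by (simp add: of_rat_add of_rat_mult of_rat_diff algebra_simps)
  from quadratic_algebraic_intD[OF irr this x(2)]
  obtain A N where A: "2 * u = of_int A" and N: "u * u - of_int m * (v * v) = of_int N"
    by (auto elim!: Ints_cases)
  obtain r e where re: "quotient_of (2 * v) = (r, e)" by force
  then have e: "e > 0" and v: "2 * v = of_int r / of_int e" and cop: "coprime r e"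
    by (auto dest: quotient_of_denom_pos quotient_of_div quotient_of_coprime)
  have "of_int m * ((2 * v) * (2 * v)) = (2 * u) * (2 * u) - 4 * (u * u - of_int m * (v * v))"
    by (simp add: algebra_simps)
  also have "\<dots> = of_int (A * A - 4 * N)" unfolding A N by simp
  finally have "of_int (m * (r * r)) = (of_int ((A * A - 4 * N) * (e * e)) :: rat)"
    using e unfolding v by (simp add: field_simps)
  then have eq: "m * (r * r) = (A * A - 4 * N) * (e * e)" unfolding of_int_eq_iff .
  then have "e * e dvd m * (r * r)" by simp
  moreover have "coprime (e * e) (r * r)" using cop by (simp add: coprime_commute)
  ultimately have "e * e dvd m" by (simp add: coprime_dvd_mult_left_iff)
  then have "e = 1" using sqf e by force
  then have "2 * v = of_int r" using v by simp
  moreover have "2 * x = of_rat (2 * u) + of_rat (2 * v) * \<gamma>" using x by (simp add: of_rat_mult algebra_simps)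
  moreover have "A * A - m * (r * r) = 4 * N" using eq \<open>e = 1\<close> by simp
  ultimately show ?thesis using A that[of A r] by simp
qed

lemma square_mod_4: "(k::int) * k mod 4 = (if even k then 0 else 1)"
proof (cases "even k")
  case True
  then show ?thesis by (auto elim!: evenE)
next
  case False
  then obtain j where "k = 2 * j + 1" by (auto elim: oddE)
  then have "k * k = 1 + 4 * (j * j + j)" by (simp add: algebra_simps)
  then have "k * k mod 4 = 1" by (simp only: mod_mult_self2) simp
  with False show ?thesis by simp
qed

text \<open>Squares are 0 or 1 modulo 4, so only the parities of \<open>A\<close> and
  \<open>B\<close> and the residue of \<open>m\<close> enter. This separates the two shapes of the
  ring of integers.\<close>

lemma quadratic_norm_form_mod_4:
  fixes A B m :: int
  assumes "(A * A - m * (B * B)) mod 4 = 0" "\<not> 4 dvd m"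
  shows "if m mod 4 = 1 then even (A - B) else even A \<and> even B"
proof -
  have "(A * A - m * (B * B)) mod 4 = (A * A mod 4 - (m mod 4) * (B * B mod 4)) mod 4"
    by (metis mod_diff_cong mod_mod_trivial mod_mult_eq)
  then have *: "((if even A then 0 else 1) - (m mod 4) * (if even B then 0 else 1)) mod 4 = (0::int)"
    using assms(1) by (simp add: square_mod_4)
  have "m mod 4 \<in> {1, 2, 3}" using assms(2) by (auto simp: dvd_eq_mod_eq_0)
  with * show ?thesis by (auto split: if_splits)
qed

text \<open>The classical choice is (1 + \<gamma>) / 2 if \<open>m\<close> is 1 modulo 4 and
  \<gamma> otherwise. Both cases end in one quadratic equation for \<open>\<omega>\<close>, so that
  the discriminant can be computed uniformly.\<close>

lemma quadratic_field_integral_basis: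
  fixes K :: "'a::field_char_0 set"
  assumes "quadratic_field K"
  obtains \<omega> t n where "\<omega> \<in> K" "\<omega> \<notin> \<rat>" "\<omega> * \<omega> = of_int t * \<omega> - of_int n" "integral_basis2 K 1 \<omega>"
    "\<And>x. x \<in> K \<Longrightarrow> \<exists>u v. x = of_rat u + of_rat v * \<omega>"
proof -
  have K: "is_subfield K" using assms by (auto simp: quadratic_field_def)
  note closed = subfield_closed[OF K] subfield_of_rat[OF K]
  obtain \<gamma> m where \<gamma>: "\<gamma> \<in> K" "\<gamma> \<notin> \<rat>" "\<gamma> * \<gamma> = of_int m" and sqf: "\<And>d. d * d dvd m \<Longrightarrow> d dvd 1"
    and gen: "\<And>x. x \<in> K \<Longrightarrow> \<exists>u v. x = of_rat u + of_rat v * \<gamma>"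
    using quadratic_field_sqrt_generator[OF assms] by metis
  have m4: "\<not> 4 dvd m" using sqf[of 2] by auto
  note result = that
  \<comment> \<open>The part common to both cases: \<open>\<gamma>\<close> and
    \<open>\<omega>\<close> have the same rational span with 1, and only the integrality of
    coordinates, \<open>coord\<close>, depends on the case.\<close>
  have main: thesis
    if \<omega>: "\<omega> = of_rat a + of_rat b * \<gamma>" "b \<noteq> 0" and sq: "\<omega> * \<omega> = of_int t * \<omega> - of_int n"
      and coord: "\<And>x A B. 2 * x = of_int A + of_int B * \<gamma> \<Longrightarrow> (A * A - m * (B * B)) mod 4 = 0 \<Longrightarrow>
        \<exists>p q. x = of_int p + of_int q * \<omega>" for \<omega> a b t n
  proof (rule result)
    show "\<omega> \<in> K" unfolding \<omega> by (intro closed(4,6,8) \<gamma>(1))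
    have \<gamma>_eq: "\<gamma> = of_rat (- a / b) + of_rat (1 / b) * \<omega>"
      using \<omega> by (simp add: of_rat_divide of_rat_minus field_simps)
    show irr: "\<omega> \<notin> \<rat>"
    proof
      assume "\<omega> \<in> \<rat>"
      then have "\<gamma> \<in> \<rat>" by (subst \<gamma>_eq) simp
      with \<gamma> show False by simp
    qed
    show "\<omega> * \<omega> = of_int t * \<omega> - of_int n" by (rule sq)
    show "\<exists>u v. x = of_rat u + of_rat v * \<omega>" if "x \<in> K" for x
    proof -
      obtain u v where "x = of_rat u + of_rat v * \<gamma>" using gen \<open>x \<in> K\<close> by blast
      then have "x = of_rat (u + v * (- a / b)) + of_rat (v * (1 / b)) * \<omega>"
        by (subst (asm) \<gamma>_eq) (simp only: of_rat_add of_rat_mult algebra_simps)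
      then show ?thesis by blast
    qed
    have "\<exists>!mn. x = of_int (fst mn) * 1 + of_int (snd mn) * \<omega>" if "x \<in> ring_of_integers K" for x
    proof -
      have x: "x \<in> K" "algebraic_int x" using that by (auto simp: ring_of_integers_def)
      then obtain u v where "x = of_rat u + of_rat v * \<gamma>" using gen by blast
      from algebraic_int_sqrt_coordinates[OF \<gamma>(2,3) sqf this x(2)] coord
      obtain p q where pq: "x = of_int p + of_int q * \<omega>" by metis
      show ?thesis
      proof (rule ex1I[of _ "(p, q)"])
        show "x = of_int (fst (p, q)) * 1 + of_int (snd (p, q)) * \<omega>" using pq by simp
        fix mn :: "int \<times> int" assume "x = of_int (fst mn) * 1 + of_int (snd mn) * \<omega>"
        then have "of_rat (of_int (fst mn)) + of_rat (of_int (snd mn)) * \<omega> =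
            of_rat (of_int p) + of_rat (of_int q) * \<omega>" using pq by simp
        then show "mn = (p, q)" unfolding irrational_combination_eq_iff[OF irr] by (simp add: prod_eq_iff)
      qed
    qed
    moreover have "algebraic_int \<omega>" using sq by (rule quadratic_algebraic_intI)
    ultimately show "integral_basis2 K 1 \<omega>"
      using \<open>\<omega> \<in> K\<close> closed(2) by (simp add: integral_basis2_def ring_of_integers_def)
  qed
  show ?thesis
  proof (cases "m mod 4 = 1")
    case True
    define k where "k = m div 4"
    have m: "m = 4 * k + 1" using True mult_div_mod_eq[of 4 m] by (simp add: k_def)
    define \<omega> where "\<omega> = (1 + \<gamma>) / 2"
    show ?thesis
    \<comment> \<open>With \<open>m = 4 * k + 1\<close> the element (1 + \<gamma>) / 2 is a root of
      X^2 - X - k.\<close>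
    proof (rule main[of \<omega> "1 / 2" "1 / 2" 1 "- k"])
      show "\<omega> = of_rat (1 / 2) + of_rat (1 / 2) * \<gamma>" by (simp add: \<omega>_def of_rat_divide add_divide_distrib)
      show "\<omega> * \<omega> = of_int 1 * \<omega> - of_int (- k)" using \<gamma>(3) m by (simp add: \<omega>_def field_simps)
      fix x A B assume x: "2 * x = of_int A + of_int B * \<gamma>" and "(A * A - m * (B * B)) mod 4 = 0"
      from quadratic_norm_form_mod_4[OF this(2) m4] True have "even (A - B)" by simp
      then obtain p where p: "A - B = 2 * p" by blast
      then have "A = B + 2 * p" by simp
      then have "2 * x = 2 * (of_int p + of_int B * \<omega>)" using x by (simp add: \<omega>_def field_simps)
      then show "\<exists>p q. x = of_int p + of_int q * \<omega>" by (metis mult_left_cancel zero_neq_numeral)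
    qed simp
  next
    case False
    show ?thesis
    proof (rule main[of \<gamma> 0 1 0 "- m"])
      show "\<gamma> * \<gamma> = of_int 0 * \<gamma> - of_int (- m)" using \<gamma>(3) by simp
      fix x A B assume x: "2 * x = of_int A + of_int B * \<gamma>" and "(A * A - m * (B * B)) mod 4 = 0"
      from quadratic_norm_form_mod_4[OF this(2) m4] False obtain p q where "A = 2 * p" "B = 2 * q" by (auto elim!: evenE)
      then have "2 * x = 2 * (of_int p + of_int q * \<gamma>)" using x by (simp add: algebra_simps)
      then show "\<exists>p q. x = of_int p + of_int q * \<gamma>" by (metis mult_left_cancel zero_neq_numeral)
    qed simp_all
  qed
qed

section \<open>Complex embeddings and the discriminant\<close>

text \<open>Unique coordinates allow \<open>\<omega>\<close> to be sent to any complex root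
  \<open>z\<close> of its equation; multiplicativity holds because products are reduced by the same
  relation on both sides.\<close>

lemma complex_embedding_quadratic_exists:
  fixes K :: "'a::field_char_0 set"
  assumes gen: "\<And>x. x \<in> K \<Longrightarrow> \<exists>u v. x = of_rat u + of_rat v * \<omega>"
    and irr: "\<omega> \<notin> \<rat>" and sq: "\<omega> * \<omega> = of_int t * \<omega> - of_int n" and z: "z * z = of_int t * z - of_int n"
  obtains \<sigma> where "complex_embedding K \<sigma>" "\<sigma> \<omega> = z"
proof -
  \<comment> \<open>Where no coordinates exist the choice is arbitrary, which is harmless because an
    embedding is constrained only on \<open>K\<close>.\<close>
  define c where "c = (\<lambda>x. SOME uv. x = of_rat (fst uv) + of_rat (snd uv) * \<omega>)"
  define \<sigma> where "\<sigma> = (\<lambda>x. of_rat (fst (c x)) + of_rat (snd (c x)) * z)"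
  have \<sigma>: "\<sigma> (of_rat u + of_rat v * \<omega>) = of_rat u + of_rat v * z" for u v
  proof -
    have "of_rat u + of_rat v * \<omega> = of_rat (fst (c (of_rat u + of_rat v * \<omega>))) + of_rat (snd (c (of_rat u + of_rat v * \<omega>))) * \<omega>"
      unfolding c_def by (rule someI[of _ "(u, v)"]) simp
    then show ?thesis unfolding irrational_combination_eq_iff[OF irr] by (simp add: \<sigma>_def)
  qed
  have "complex_embedding K \<sigma>"
    unfolding complex_embedding_def
  proof (intro conjI ballI)
    show "\<sigma> 1 = 1" using \<sigma>[of 1 0] by simp
    fix x y assume "x \<in> K" "y \<in> K"
    then obtain u v u' v' where xy: "x = of_rat u + of_rat v * \<omega>" "y = of_rat u' + of_rat v' * \<omega>"
      using gen by metis
    have "x + y = of_rat (u + u') + of_rat (v + v') * \<omega>" unfolding xy by (simp add: of_rat_add algebra_simps)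
    then have "\<sigma> (x + y) = of_rat (u + u') + of_rat (v + v') * z" using \<sigma> by metis
    then show "\<sigma> (x + y) = \<sigma> x + \<sigma> y" unfolding xy \<sigma> by (simp add: of_rat_add algebra_simps)
    \<comment> \<open>These identities are polymorphic so that they rewrite the product in the
      ambient field and its complex image alike.\<close>
    have expand: "(a + b * w) * (a' + b' * w) = a * a' + (a * b' + a' * b) * w + b * b' * (w * w)"
      for a b a' b' w :: "'c::comm_ring_1" by (simp add: algebra_simps)
    have collect: "a + b * w + d * (t' * w - n') = a - d * n' + (b + d * t') * w"
      for a b d t' n' w :: "'c::comm_ring_1" by (simp add: algebra_simps)
    have hom: "of_rat (u * u' - v * v' * of_int n) = (of_rat u * of_rat u' - of_rat v * of_rat v' * of_int n :: 'd::field_char_0)"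
      "of_rat (u * v' + u' * v + v * v' * of_int t) =
        (of_rat u * of_rat v' + of_rat u' * of_rat v + of_rat v * of_rat v' * of_int t :: 'd)" for u u' v v'
      by (simp_all add: of_rat_add of_rat_mult of_rat_diff)
    have "x * y = of_rat (u * u' - v * v' * of_int n) + of_rat (u * v' + u' * v + v * v' * of_int t) * \<omega>"
      unfolding xy expand sq collect hom ..
    then have "\<sigma> (x * y) = of_rat (u * u' - v * v' * of_int n) + of_rat (u * v' + u' * v + v * v' * of_int t) * z"
      using \<sigma> by metis
    then show "\<sigma> (x * y) = \<sigma> x * \<sigma> y" unfolding xy \<sigma> expand z collect hom .
  qed
  moreover have "\<sigma> \<omega> = z" using \<sigma>[of 0 1] by simp
  ultimately show ?thesis using that by blast
qed

text \<open>Additivity and \<open>\<sigma> 1 = 1\<close> force an embedding to fix the natural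
  numbers, by induction, and then their negatives.\<close>

lemma complex_embedding_of_int_combination:
  fixes K :: "'a::field_char_0 set"
  assumes "is_subfield K" "complex_embedding K \<sigma>" "x \<in> K"
  shows "\<sigma> (of_int p + of_int q * x) = of_int p + of_int q * \<sigma> x"
proof -
  note closed = subfield_closed[OF assms(1)] 
  have \<sigma>: "\<sigma> 1 = 1" and add: "\<And>x y. x \<in> K \<Longrightarrow> y \<in> K \<Longrightarrow> \<sigma> (x + y) = \<sigma> x + \<sigma> y"
    and mult: "\<And>x y. x \<in> K \<Longrightarrow> y \<in> K \<Longrightarrow> \<sigma> (x * y) = \<sigma> x * \<sigma> y"
    using assms(2) by (auto simp: complex_embedding_def)
  have int_mem: "of_int i \<in> K" for i
    using subfield_of_rat[OF assms(1), of "of_int i"] by simp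
  have \<sigma>0: "\<sigma> 0 = 0" using add[OF closed(1) closed(1)] by simp
  have nat: "\<sigma> (of_nat i) = of_nat i" for i
  proof (induction i)
    case (Suc i)
    then show ?case using add[OF closed(2) int_mem[of "int i"]] \<sigma> by simp
  qed (simp add: \<sigma>0)
  have int: "\<sigma> (of_int i) = of_int i" for i
  proof (cases i rule: int_cases2)
    case (nonneg k)
    then show ?thesis using nat by simp
  next
    case (nonpos k)
    have "\<sigma> (- of_nat k) + \<sigma> (of_nat k) = 0"
      using add[OF int_mem[of "- int k"] int_mem[of "int k"]] \<sigma>0 by simp
    then have "\<sigma> (- of_nat k) = - of_nat k" using nat by (simp add: eq_neg_iff_add_eq_0)
    moreover have "i = - int k" using nonpos by simp
    ultimately show ?thesis by simp
  qed
  show ?thesis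
    using add[OF int_mem[of p] closed(4)[OF int_mem[of q] assms(3)]] mult[OF int_mem[of q] assms(3)] int by simp
qed

lemma integral_basis2D:
  assumes "integral_basis2 K b1 b2"
  shows "b1 \<in> ring_of_integers K" "b2 \<in> ring_of_integers K"
    "x \<in> ring_of_integers K \<Longrightarrow> \<exists>p q. x = of_int p * b1 + of_int q * b2"
proof -
  show "b1 \<in> ring_of_integers K" "b2 \<in> ring_of_integers K" using assms by (simp_all add: integral_basis2_def)
  assume "x \<in> ring_of_integers K"
  then have "\<exists>!mn. x = of_int (fst mn) * b1 + of_int (snd mn) * b2" using assms by (simp add: integral_basis2_def)
  from ex1_implies_ex[OF this] show "\<exists>p q. x = of_int p * b1 + of_int q * b2" by (elim exE) (intro exI)
qed

text \<open>
  Both the basis and the embeddings in the definition of the discriminant may be replaced: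
  a change of basis multiplies the determinant by \<open>\<plusminus>1\<close>, and distinct embeddings map \<open>\<omega>\<close> to the two
  distinct roots of its minimal polynomial.
\<close>

lemma field_disc_eq:
  fixes K :: "'a::field_char_0 set"
  assumes K: "is_subfield K" and gen: "\<And>x. x \<in> K \<Longrightarrow> \<exists>u v. x = of_rat u + of_rat v * \<omega>"
    and \<omega>: "\<omega> \<in> K" "\<omega> \<notin> \<rat>" and sq: "\<omega> * \<omega> = of_int t * \<omega> - of_int n" and basis: "integral_basis2 K 1 \<omega>"
  shows "field_disc K = t * t - 4 * n" "field_disc K \<noteq> 0"
proof -
  note comb = complex_embedding_of_int_combination[OF K _ \<omega>(1)]
  define D where "D = t * t - 4 * n"
  have D0: "D \<noteq> 0"
  proof
    assume "D = 0"
    have "(2 * \<omega> - of_int t) * (2 * \<omega> - of_int t) = 4 * (\<omega> * \<omega>) - 4 * of_int t * \<omega> + of_int t * of_int t"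
      by (simp add: algebra_simps)
    also have "\<dots> = of_int D" unfolding sq by (simp add: D_def algebra_simps)
    finally have "\<omega> = of_int t / 2" using \<open>D = 0\<close> by (simp add: nonzero_eq_divide_eq mult.commute)
    then have "\<omega> \<in> \<rat>" by (simp only: Rats_divide Rats_of_int Rats_number_of)
    with \<omega> show False by simp
  qed
  have root: "\<sigma> \<omega> * \<sigma> \<omega> = of_int t * \<sigma> \<omega> - of_int n" if "complex_embedding K \<sigma>" for \<sigma>
  proof -
    have "\<sigma> \<omega> * \<sigma> \<omega> = \<sigma> (\<omega> * \<omega>)" using that \<omega> by (simp add: complex_embedding_def)
    also have "\<omega> * \<omega> = of_int (- n) + of_int t * \<omega>" using sq by simp
    finally show ?thesis using comb[OF that, of "- n" t] by simp
  qed
  have disc: "(\<tau> \<omega> - \<sigma> \<omega>)\<^sup>2 = of_int D"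
    if \<sigma>: "complex_embedding K \<sigma>" and \<tau>: "complex_embedding K \<tau>" and ne: "\<exists>x\<in>K. \<sigma> x \<noteq> \<tau> x" for \<sigma> \<tau>
  proof -
    \<comment> \<open>An embedding is determined on \<open>K\<close> by its value at
      \<open>\<omega>\<close>: multiplying \<open>x\<close> by the common denominator
      \<open>c * e\<close> gives an integer combination of 1 and \<open>\<omega>\<close>.\<close>
    have "\<sigma> \<omega> \<noteq> \<tau> \<omega>"
    proof
      assume eq: "\<sigma> \<omega> = \<tau> \<omega>"
      obtain x where x: "x \<in> K" "\<sigma> x \<noteq> \<tau> x" using ne by blast
      obtain u v where uv: "x = of_rat u + of_rat v * \<omega>" using gen x by blast
      obtain a c where "quotient_of u = (a, c)" by force
      then have c: "c > 0" and u: "u = of_int a / of_int c" by (auto dest: quotient_of_denom_pos quotient_of_div)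
      obtain b e where "quotient_of v = (b, e)" by force
      then have e: "e > 0" and v: "v = of_int b / of_int e" by (auto dest: quotient_of_denom_pos quotient_of_div)
      have "of_int 0 + of_int (c * e) * x = of_int (a * e) + of_int (b * c) * \<omega>"
        using c e unfolding uv u v by (simp add: of_rat_divide field_simps)
      then have "of_int (c * e) * \<sigma> x = of_int (c * e) * \<tau> x"
        using comb[OF \<sigma>, of "a * e" "b * c"] comb[OF \<tau>, of "a * e" "b * c"] eq
          complex_embedding_of_int_combination[OF K \<sigma> x(1), of 0 "c * e"]
          complex_embedding_of_int_combination[OF K \<tau> x(1), of 0 "c * e"] by simp
      with c e x(2) show False by simp
    qed
    \<comment> \<open>Subtracting the two quadratic equations shows that the distinct roots have sum
      \<open>t\<close>. Their difference is therefore t - 2 \<sigma>(\<omega>), whose square is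
      \<open>D\<close>.\<close>
    moreover have "(\<sigma> \<omega> - \<tau> \<omega>) * (\<sigma> \<omega> + \<tau> \<omega> - of_int t) =
        (\<sigma> \<omega> * \<sigma> \<omega> - of_int t * \<sigma> \<omega>) - (\<tau> \<omega> * \<tau> \<omega> - of_int t * \<tau> \<omega>)"
      by (simp add: algebra_simps)
    then have "(\<sigma> \<omega> - \<tau> \<omega>) * (\<sigma> \<omega> + \<tau> \<omega> - of_int t) = 0"
      unfolding root[OF \<sigma>] root[OF \<tau>] by simp
    ultimately have "\<sigma> \<omega> + \<tau> \<omega> - of_int t = 0" by (metis eq_iff_diff_eq_0 mult_eq_0_iff)
    then have \<tau>_eq: "\<tau> \<omega> = of_int t - \<sigma> \<omega>" by (simp add: algebra_simps)
    have "(\<tau> \<omega> - \<sigma> \<omega>)\<^sup>2 = 4 * (\<sigma> \<omega> * \<sigma> \<omega>) - 4 * of_int t * \<sigma> \<omega> + of_int t * of_int t"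
      unfolding \<tau>_eq by (simp add: power2_eq_square algebra_simps)
    also have "\<dots> = of_int D" unfolding root[OF \<sigma>] by (simp add: D_def algebra_simps)
    finally show ?thesis .
  qed
  have "field_disc K = D"
    unfolding field_disc_def
  proof (rule the_equality)
    \<comment> \<open>The quadratic formula supplies both roots; they differ because
      \<open>D\<close> is nonzero, so they induce different embeddings.\<close>
    define z where "z = (of_int t + csqrt (of_int D)) / 2"
    define z' where "z' = (of_int t - csqrt (of_int D)) / 2"
    have s: "csqrt (of_int D) * csqrt (of_int D) = of_int D" using power2_csqrt by (simp add: power2_eq_square)
    have "z * z = of_int t * z - of_int n" "z' * z' = of_int t * z' - of_int n"
    proof -
      have root: "(of_int t + w) / 2 * ((of_int t + w) / 2) = of_int t * ((of_int t + w) / 2) - of_int n"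
        if "w * w = of_int D" for w :: complex
      proof -
        have "(of_int t + w) / 2 * ((of_int t + w) / 2) = (of_int t * of_int t + 2 * of_int t * w + w * w) / 4"
          by (simp add: algebra_simps add_divide_distrib)
        also have "\<dots> = of_int t * ((of_int t + w) / 2) - of_int n"
          unfolding that by (simp add: D_def field_simps)
        finally show ?thesis .
      qed
      show "z * z = of_int t * z - of_int n" "z' * z' = of_int t * z' - of_int n"
        using root[OF s] root[of "- csqrt (of_int D)"] s by (simp_all add: z_def z'_def)
    qed
    then obtain \<sigma> \<tau> where \<sigma>: "complex_embedding K \<sigma>" "\<sigma> \<omega> = z" and \<tau>: "complex_embedding K \<tau>" "\<tau> \<omega> = z'"
      using complex_embedding_quadratic_exists[OF gen \<omega>(2) sq] by metis
    have "csqrt (of_int D) \<noteq> 0" using D0 by simp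
    then have "z \<noteq> z'" by (simp add: z_def z'_def field_simps)
    then have ne: "\<exists>x\<in>K. \<sigma> x \<noteq> \<tau> x" using \<sigma> \<tau> \<omega> by auto
    have "\<sigma> 1 = 1" "\<tau> 1 = 1" using \<sigma> \<tau> by (auto simp: complex_embedding_def)
    then have "of_int D = (\<sigma> 1 * \<tau> \<omega> - \<sigma> \<omega> * \<tau> 1)\<^sup>2" using disc[OF \<sigma>(1) \<tau>(1) ne] by simp
    with basis \<sigma> \<tau> ne show "\<exists>b1 b2 \<sigma> \<tau>. integral_basis2 K b1 b2 \<and> complex_embedding K \<sigma> \<and> complex_embedding K \<tau> \<and>
      (\<exists>x\<in>K. \<sigma> x \<noteq> \<tau> x) \<and> of_int D = (\<sigma> b1 * \<tau> b2 - \<sigma> b2 * \<tau> b1)\<^sup>2" by blast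
  next
    fix E assume "\<exists>b1 b2 \<sigma> \<tau>. integral_basis2 K b1 b2 \<and> complex_embedding K \<sigma> \<and> complex_embedding K \<tau> \<and>
      (\<exists>x\<in>K. \<sigma> x \<noteq> \<tau> x) \<and> of_int E = (\<sigma> b1 * \<tau> b2 - \<sigma> b2 * \<tau> b1)\<^sup>2"
    then obtain b1 b2 \<sigma> \<tau> where b: "integral_basis2 K b1 b2" and \<sigma>: "complex_embedding K \<sigma>"
      and \<tau>: "complex_embedding K \<tau>" and ne: "\<exists>x\<in>K. \<sigma> x \<noteq> \<tau> x"
      and E: "of_int E = (\<sigma> b1 * \<tau> b2 - \<sigma> b2 * \<tau> b1)\<^sup>2" by blast
    have bO: "b1 \<in> ring_of_integers K" "b2 \<in> ring_of_integers K"
      and bgen: "\<And>x. x \<in> ring_of_integers K \<Longrightarrow> \<exists>p q. x = of_int p * b1 + of_int q * b2"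
      using integral_basis2D[OF b] .
    have eO: "1 \<in> ring_of_integers K" "\<omega> \<in> ring_of_integers K"
      and egen: "\<And>x. x \<in> ring_of_integers K \<Longrightarrow> \<exists>p q. x = of_int p + of_int q * \<omega>"
      using integral_basis2D[OF basis] by simp_all
    obtain p1 q1 p2 q2 where p: "b1 = of_int p1 + of_int q1 * \<omega>" "b2 = of_int p2 + of_int q2 * \<omega>"
      using egen bO by metis
    obtain r1 s1 r2 s2 where r: "1 = of_int r1 * b1 + of_int s1 * b2" "\<omega> = of_int r2 * b1 + of_int s2 * b2"
      using bgen eO by metis
    define det where "det = p1 * q2 - p2 * q1"
    \<comment> \<open>The two transition matrices are mutually inverse, so taking determinants makes
      \<open>det\<close> a unit among the integers.\<close>
    have det: "(r1 * s2 - r2 * s1) * det = 1"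
    proof -
      have "of_int (r1 * p1 + s1 * p2) + of_int (r1 * q1 + s1 * q2) * \<omega> = of_int 1 + of_int 0 * \<omega>"
        using r(1) unfolding p by (simp add: algebra_simps)
      moreover have "of_int (r2 * p1 + s2 * p2) + of_int (r2 * q1 + s2 * q2) * \<omega> = of_int 0 + of_int 1 * \<omega>"
        using r(2) unfolding p by (simp add: algebra_simps)
      ultimately have eqs: "r1 * p1 + s1 * p2 = 1" "r1 * q1 + s1 * q2 = 0" "r2 * p1 + s2 * p2 = 0" "r2 * q1 + s2 * q2 = 1"
        unfolding irrational_int_combination_eq_iff[OF \<omega>(2)] by simp_all
      have "(r1 * s2 - r2 * s1) * det = (r1 * p1 + s1 * p2) * (r2 * q1 + s2 * q2) - (r1 * q1 + s1 * q2) * (r2 * p1 + s2 * p2)"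
        by (simp add: det_def algebra_simps)
      then show ?thesis using eqs by simp
    qed
    then have "det dvd 1" by (metis dvd_triv_right)
    then have "det * det = 1" by (auto simp: abs_if zdvd1_eq split: if_splits)
    have "\<sigma> b1 * \<tau> b2 - \<sigma> b2 * \<tau> b1 = of_int det * (\<tau> \<omega> - \<sigma> \<omega>)"
      unfolding p comb[OF \<sigma>] comb[OF \<tau>] by (simp add: det_def algebra_simps)
    then have "of_int E = of_int (det * det) * (\<tau> \<omega> - \<sigma> \<omega>)\<^sup>2" using E by (simp add: power2_eq_square)
    then show "E = D" using disc[OF \<sigma> \<tau> ne] \<open>det * det = 1\<close> by simp
  qed
  with D0 show "field_disc K = t * t - 4 * n" "field_disc K \<noteq> 0" by (auto simp: D_def)
qed

lemma field_disc_nonzero: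
  assumes "quadratic_field K"
  shows "field_disc K \<noteq> 0"
  using quadratic_field_integral_basis[OF assms] field_disc_eq(2) assms
  unfolding quadratic_field_def by metis

subsection \<open>Euler products\<close>

lemma kronecker_1: "kronecker a (Suc 0) = 1"
  by (simp add: kronecker_def)

lemma kronecker_mult:
  assumes "m > 0" "n > 0"
  shows "kronecker a (m * n) = kronecker a m * kronecker a n"
  using assms by (simp add: kronecker_def prime_factorization_mult)

lemma kronecker_prime_eq: "prime p \<Longrightarrow> kronecker a p = kronecker_prime a p"
  by (auto simp: kronecker_def prime_factorization_prime dest: prime_gt_0_nat)

lemma kronecker_prime_range: "kronecker_prime a p \<in> {-1, 0, 1}"
  by (simp add: kronecker_prime_def Legendre_def)

lemma kronecker_prime_eq_0_iff: "kronecker_prime a p = 0 \<longleftrightarrow> p dvd nat \<bar>a\<bar>"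
  by (auto simp: kronecker_prime_def Legendre_def cong_0_iff)

lemma abs_kronecker_le_1: "\<bar>kronecker a n\<bar> \<le> 1"
proof (cases "n = 0")
  case False
  have "\<bar>\<Prod>p\<in>#M. kronecker_prime a p\<bar> \<le> 1" for M
  proof (induction M)
    case (add p M)
    have "\<bar>kronecker_prime a p\<bar> \<le> 1" using kronecker_prime_range[of a p] by auto
    then have "\<bar>kronecker_prime a p\<bar> * \<bar>\<Prod>p\<in>#M. kronecker_prime a p\<bar> \<le> 1 * 1"
      using add by (intro mult_mono) auto
    then show ?case by (simp add: abs_mult)
  qed simp
  with False show ?thesis by (simp add: kronecker_def)
qed (simp add: kronecker_def)

section \<open>Euler products of completely multiplicative functions\<close>

text \<open>Induction on the set of primes: after adjoining \<open>q\<close>, the admissible numbers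
  are the old ones together with \<open>q\<close> times all admissible ones. So the new sum S
  satisfies S = S_old + f(q) S, which is solved directly instead of expanding a geometric
  series.\<close>

lemma smooth_sum_eq_prod:
  fixes f :: "nat \<Rightarrow> complex"
  assumes f1: "f 1 = 1" and mult: "\<And>m n. m > 0 \<Longrightarrow> n > 0 \<Longrightarrow> f (m * n) = f m * f n"
    and summ: "f summable_on UNIV" and ne: "\<And>p. prime p \<Longrightarrow> f p \<noteq> 1"
    and A: "finite A" "\<forall>p\<in>A. prime p"
  shows "infsum f {n. n > 0 \<and> prime_factors n \<subseteq> A} = (\<Prod>p\<in>A. inverse (1 - f p))"
  using A
proof (induction A rule: finite_induct)
  case empty
  have "{n::nat. n > 0 \<and> prime_factors n \<subseteq> {}} = {1}"
    by (auto simp: prime_factorization_empty_iff)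
  then show ?case using f1 by simp
next
  case (insert q A)
  then have q: "prime q" by simp
  define U where "U = {n::nat. n > 0 \<and> prime_factors n \<subseteq> A}"
  define T where "T = {n::nat. n > 0 \<and> prime_factors n \<subseteq> insert q A}"
  have summ': "f summable_on B" for B using summ by (rule summable_on_subset_banach) simp
  have T: "T = U \<union> (\<lambda>m. q * m) ` T"
  proof (intro equalityI subsetI)
    fix n assume n: "n \<in> T"
    show "n \<in> U \<union> (\<lambda>m. q * m) ` T"
    proof (cases "q dvd n")
      case True
      then obtain m where m: "n = q * m" by blast
      then have "m \<in> T" using n q by (auto simp: T_def prime_factorization_mult)
      with m show ?thesis by blast
    next
      case False
      then show ?thesis using n by (auto simp: T_def U_def)
    qed
  next
    fix n assume "n \<in> U \<union> (\<lambda>m. q * m) ` T"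
    then show "n \<in> T"
      using q prime_gt_0_nat[OF q] by (auto simp: T_def U_def prime_factorization_mult prime_factorization_prime)
  qed
  have disj: "U \<inter> (\<lambda>m. q * m) ` T = {}"
  proof (rule ccontr)
    assume "U \<inter> (\<lambda>m. q * m) ` T \<noteq> {}"
    then obtain m where "q * m \<in> U" by auto
    then have "q \<in> A" using q by (auto simp: U_def prime_factorization_mult prime_factorization_prime)
    with insert show False by simp
  qed
  have "infsum f T = infsum f (U \<union> (\<lambda>m. q * m) ` T)" by (rule arg_cong[OF T])
  also have "\<dots> = infsum f U + infsum f ((\<lambda>m. q * m) ` T)"
    by (rule infsum_Un_disjoint[OF summ' summ' disj])
  also have "infsum f ((\<lambda>m. q * m) ` T) = infsum (\<lambda>m. f (q * m)) T"
    using prime_gt_0_nat[OF q] by (subst infsum_reindex) (auto simp: inj_on_def o_def)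
  also have "\<dots> = infsum (\<lambda>m. f q * f m) T"
    using prime_gt_0_nat[OF q] by (intro infsum_cong mult) (auto simp: T_def)
  also have "\<dots> = f q * infsum f T" by (rule infsum_cmult_right')
  finally have "(1 - f q) * infsum f T = infsum f U"
    by (metis add_diff_cancel_right' left_diff_distrib mult_1)
  then have "infsum f T = inverse (1 - f q) * infsum f U" using ne[OF q] by (simp add: field_simps)
  with insert show ?case by (simp add: T_def U_def)
qed

text \<open>The finite Euler products are exponentials of partial sums of \<open>l\<close>, and they
  are also sums of \<open>f\<close> over smooth numbers. Both sides converge, and limits are
  unique.\<close>

lemma euler_product_exp:
  fixes f l :: "nat \<Rightarrow> complex"
  assumes f0: "f 0 = 0" and f1: "f 1 = 1"
    and mult: "\<And>m n. m > 0 \<Longrightarrow> n > 0 \<Longrightarrow> f (m * n) = f m * f n"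
    and summ: "summable (\<lambda>n. norm (f n))" and ne: "\<And>p. prime p \<Longrightarrow> f p \<noteq> 1"
    and l: "\<And>p. prime p \<Longrightarrow> exp (l p) = inverse (1 - f p)"
    and L: "(\<lambda>p. if prime p then l p else 0) sums L"
  shows "(\<Sum>n. f (Suc n)) = exp L"
proof -
  have summ': "f summable_on UNIV" using summ by (rule norm_summable_imp_summable_on)
  define B where "B = (\<lambda>N. {n::nat. n > 0 \<and> prime_factors n \<subseteq> {p. prime p \<and> p \<le> N}})"
  have suminf_B: "(\<Sum>n. if n \<in> B N then f n else 0) = (\<Prod>p | prime p \<and> p \<le> N. inverse (1 - f p))" for N
  proof -
    have "(f has_sum infsum f (B N)) (B N)"
      using summ' by (intro has_sum_infsum summable_on_subset_banach[OF summ']) auto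
    then have "((\<lambda>n. if n \<in> B N then f n else 0) has_sum infsum f (B N)) UNIV"
      by (rule has_sum_cong_neutral[THEN iffD1, rotated -1]) auto
    then have "(\<Sum>n. if n \<in> B N then f n else 0) = infsum f (B N)"
      by (intro sums_unique[symmetric] has_sum_imp_sums)
    also have "\<dots> = (\<Prod>p | prime p \<and> p \<le> N. inverse (1 - f p))"
      unfolding B_def by (rule smooth_sum_eq_prod) (use f1 mult summ' ne in auto)
    finally show ?thesis .
  qed
  \<comment> \<open>The terms are dominated by \<open>norm (f n)\<close> uniformly in
    \<open>N\<close>, so Tannery's theorem moves the limit inside the sum.\<close>
  have "(\<lambda>N. \<Sum>n. if n \<in> B N then f n else 0) \<longlonglongrightarrow> suminf f"
  proof (rule tannerys_theorem[THEN conjunct2, THEN conjunct2])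
    show "(\<lambda>N. if n \<in> B N then f n else 0) \<longlonglongrightarrow> f n" for n
    proof (rule tendsto_eventually)
      show "\<forall>\<^sub>F N in sequentially. (if n \<in> B N then f n else 0) = f n"
        using eventually_ge_at_top[of n]
      proof eventually_elim
        case (elim N)
        show ?case
        proof (cases "n = 0")
          case False
          \<comment> \<open>Prime factors of a positive \<open>n\<close> are at most
            \<open>n\<close>. The index 0 never enters \<open>B N\<close> and is covered by
            \<open>f 0 = 0\<close>.\<close>
          then have "n \<in> B N" using elim by (auto simp: B_def in_prime_factors_iff dest!: dvd_imp_le)
          then show ?thesis by simp
        qed (simp add: f0)
      qed
    qed
    show "summable (\<lambda>n. norm (f n))" by (rule summ)
  qed (auto intro!: always_eventually)
  then have "(\<lambda>N. \<Prod>p | prime p \<and> p \<le> N. inverse (1 - f p)) \<longlonglongrightarrow> suminf f" unfolding suminf_B .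
  moreover have "(\<lambda>N. exp (\<Sum>p\<le>N. if prime p then l p else 0)) \<longlonglongrightarrow> exp L"
    using L by (intro tendsto_exp) (simp add: sums_def_le)
  moreover have "exp (\<Sum>p\<le>N. if prime p then l p else 0) = (\<Prod>p | prime p \<and> p \<le> N. inverse (1 - f p))" for N
  proof -
    have "(\<Sum>p\<le>N. if prime p then l p else 0) = (\<Sum>p | prime p \<and> p \<le> N. l p)"
      by (intro sum.mono_neutral_cong_right) auto
    then show ?thesis using l by (simp add: exp_sum)
  qed
  ultimately have "suminf f = exp L" using LIMSEQ_unique by simp
  moreover have "(\<Sum>n. f (Suc n)) = suminf f"
    using suminf_split_head[OF summable_norm_cancel[OF summ]] f0 by simp
  ultimately show ?thesis by simp
qed

section \<open>Logarithms of partial Euler products\<close>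

text \<open>A logarithm of the Euler product over the primes in \<open>A\<close>, whose branch is
  fixed factor by factor and not by the value of the product. The parameter \<open>A\<close> treats
  split, inert and ramified primes uniformly.\<close>

definition prime_log :: "nat set \<Rightarrow> complex \<Rightarrow> complex" where
  "prime_log A s = (\<Sum>p. if prime p \<and> p \<in> A then - Ln (1 - of_nat p powr (-s)) else 0)"

lemma norm_of_nat_powr: "norm (of_nat n powr (-s) :: complex) = real n powr (- Re s)"
  by (simp add: norm_powr_real_powr)

lemma norm_prime_powr_le:
  assumes "prime p" "Re s \<ge> c" "c \<ge> 0"
  shows "norm (of_nat p powr (-s) :: complex) \<le> 2 powr (- c)"
proof -
  have "real p powr (- Re s) \<le> 2 powr (- Re s)"
    using prime_ge_2_nat[OF assms(1)] assms by (intro powr_mono2') auto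
  also have "\<dots> \<le> 2 powr (- c)" using assms by (intro powr_mono) auto
  finally show ?thesis by (simp add: norm_of_nat_powr)
qed

text \<open>The linear approximation of \<open>Ln\<close> has error at most |w|^2 / (1 - |w|), and
  adding |w| gives |w| / (1 - |w|). The values 1/2 and 1/4 of \<open>c\<close> later produce the
  constants 2 and 4/3.\<close>

lemma norm_Ln_one_minus_le:
  fixes w :: complex
  assumes "norm w \<le> c" "c < 1"
  shows "norm (Ln (1 - w)) \<le> norm w / (1 - c)"
proof -
  have "norm (Ln (1 + (- w)) - (- w)) \<le> norm w ^ 2 / (1 - norm w)"
    using Ln_approx_linear[of "- w"] assms by simp
  then have "norm (Ln (1 - w)) \<le> norm w + norm w ^ 2 / (1 - norm w)"
    using norm_triangle_ineq4[of "Ln (1 - w) + w" w] by simp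
  also have "\<dots> = norm w / (1 - norm w)" using assms by (simp add: field_simps power2_eq_square)
  also have "\<dots> \<le> norm w / (1 - c)" using assms by (intro divide_left_mono) (auto intro!: mult_pos_pos)
  finally show ?thesis .
qed

lemma prime_log_sums:
  assumes "Re s > 1"
  shows "(\<lambda>p. if prime p \<and> p \<in> A then - Ln (1 - of_nat p powr (-s)) else 0) sums prime_log A s"
proof -
  have bound: "norm (if prime p \<and> p \<in> A then - Ln (1 - of_nat p powr (-s)) else 0) \<le> 2 * real p powr (- Re s)" for p
  proof (cases "prime p \<and> p \<in> A")
    case True
    then have "norm (of_nat p powr (-s) :: complex) \<le> 1 / 2"
      using norm_prime_powr_le[of p 1 s] assms by (simp add: powr_minus_divide)
    from norm_Ln_one_minus_le[OF this] True show ?thesis by (simp add: norm_of_nat_powr)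
  qed auto
  have "summable (\<lambda>p. 2 * real p powr (- Re s))"
    using assms by (intro summable_mult) (simp add: summable_real_powr_iff)
  then have "summable (\<lambda>p. if prime p \<and> p \<in> A then - Ln (1 - of_nat p powr (-s)) else 0)"
    by (rule summable_comparison_test') (rule bound)
  then show ?thesis unfolding prime_log_def by (rule summable_sums)
qed

lemma prime_powr_neq_1:
  assumes "prime p" "Re s > 0"
  shows "of_nat p powr (-s) \<noteq> (1::complex)"
proof -
  have "norm (of_nat p powr (-s) :: complex) < 1"
    unfolding norm_of_nat_powr using prime_gt_1_nat[OF assms(1)] assms(2) by (intro powr_less_one) auto
  then show ?thesis by auto
qed

lemma exp_minus_Ln_prime:
  assumes "prime p" "Re s > 0"
  shows "exp (- Ln (1 - of_nat p powr (-s))) = inverse (1 - of_nat p powr (-s))"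
  using prime_powr_neq_1[OF assms] by (simp add: exp_minus)

text \<open>The exponential of a convergent series is an infinite product with nonzero limit, as
  \<open>has_prod\<close> demands.\<close>

lemma prime_prodinf_eq_exp_prime_log:
  assumes "Re s > 1"
  shows "prime_prodinf P (\<lambda>p. inverse (1 - of_nat p powr (-s))) = exp (prime_log {p. P p} s)"
proof -
  have "(\<lambda>p. exp (if prime p \<and> p \<in> {p. P p} then - Ln (1 - of_nat p powr (-s)) else 0)) has_prod
      exp (prime_log {p. P p} s)"
    using sums_imp_has_prod_exp[OF prime_log_sums[OF assms]] unfolding has_prod_def by blast
  also have "(\<lambda>p. exp (if prime p \<and> p \<in> {p. P p} then - Ln (1 - of_nat p powr (-s)) else 0)) =
      (\<lambda>p. if prime p \<and> P p then inverse (1 - of_nat p powr (-s)) else 1)"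
    using exp_minus_Ln_prime assms by auto
  finally show ?thesis unfolding prime_prodinf_def by (rule has_prod_unique[symmetric])
qed

lemma prime_log_Un:
  assumes "Re s > 1" "A \<inter> B = {}"
  shows "prime_log (A \<union> B) s = prime_log A s + prime_log B s"
proof (rule sums_unique2[OF prime_log_sums[OF assms(1)]])
  show "(\<lambda>p. if prime p \<and> p \<in> A \<union> B then - Ln (1 - of_nat p powr (-s)) else 0) sums (prime_log A s + prime_log B s)"
    using sums_add[OF prime_log_sums[OF assms(1), of A] prime_log_sums[OF assms(1), of B]]
    by (rule back_subst[of "\<lambda>f. f sums _"]) (use assms(2) in \<open>auto simp: fun_eq_iff\<close>)
qed

lemma exp_prime_log_finite:
  assumes "Re s > 1" "finite {p. prime p \<and> P p}"
  shows "exp (prime_log {p. P p} s) = (\<Prod>p | prime p \<and> P p. inverse (1 - of_nat p powr (-s)))"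
proof -
  have "prime_log {p. P p} s = (\<Sum>p | prime p \<and> P p. - Ln (1 - of_nat p powr (-s)))"
    unfolding prime_log_def
    by (subst suminf_finite[OF assms(2)]) (auto intro!: sum.cong)
  then show ?thesis using assms(1) by (simp add: exp_sum[OF assms(2)] exp_minus_Ln_prime del: sum_negf)
qed

lemma of_nat_powr_mult:
  "of_nat (m * n) powr (-s) = of_nat m powr (-s) * (of_nat n powr (-s) :: complex)"
  using powr_times_real[of "of_nat m" "of_nat n" "-s"] by simp

lemma of_nat_powr_double: "of_nat p powr (- (2 * s)) = (of_nat p powr (- s) :: complex)\<^sup>2"
  by (simp add: powr_def exp_double[symmetric] mult_ac)

text \<open>Where \<open>c p = -1\<close> the Euler factor is 1 / (1 + z) = (1 - z) / (1 - z^2) with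
  z = p^(-s). This expresses it by the same kind of logarithm at \<open>2 * s\<close> and at
  \<open>s\<close>.\<close>

lemma L_series_eq_exp:
  fixes c :: "nat \<Rightarrow> int"
  assumes s: "Re s > 1" and c1: "c 1 = 1" and mult: "\<And>m n. m > 0 \<Longrightarrow> n > 0 \<Longrightarrow> c (m * n) = c m * c n"
    and bound: "\<And>n. \<bar>c n\<bar> \<le> 1"
  shows "L_series c s = exp (prime_log {p. c p = 1} s + (prime_log {p. c p = -1} (2 * s) - prime_log {p. c p = -1} s))"
proof -
  define z where "z = (\<lambda>p::nat. of_nat p powr (-s) :: complex)"
  define l where "l = (\<lambda>p. if c p = 1 then - Ln (1 - z p)
    else if c p = -1 then - Ln (1 - of_nat p powr (- (2 * s))) + Ln (1 - z p) else 0)"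
  define f where "f = (\<lambda>n. of_int (c n) * z n)"
  have s2: "Re (2 * s) > 1" using s by simp
  have cases: "c n = 1 \<or> c n = -1 \<or> c n = 0" for n using bound[of n] by (auto simp: abs_le_iff)
  have nz: "norm (z p) < 1" if "prime p" for p
    using norm_prime_powr_le[OF that, of 1 s] s by (simp add: z_def powr_minus_divide)
  have nf: "norm (f n) \<le> norm (z n)" for n using cases[of n] by (auto simp: f_def)
  have "(\<Sum>n. f (Suc n)) = exp (prime_log {p. c p = 1} s + (prime_log {p. c p = -1} (2 * s) - prime_log {p. c p = -1} s))"
  proof (rule euler_product_exp)
    \<comment> \<open>The convention \<open>0 powr (-s) = 0\<close> gives \<open>f 0 = 0\<close>
      whatever the value of \<open>c 0\<close>.\<close>
    show "f 0 = 0" "f 1 = 1" using c1 by (auto simp: f_def z_def)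
    show "f (m * n) = f m * f n" if "m > 0" "n > 0" for m n
      using mult[OF that] by (simp add: f_def z_def of_nat_powr_mult del: of_nat_mult)
    have "summable (\<lambda>n. norm (z n))"
      using s by (simp add: z_def norm_of_nat_powr summable_real_powr_iff)
    then show "summable (\<lambda>n. norm (f n))"
      by (rule summable_comparison_test'[where N = 0]) (use nf in auto)
    show "f p \<noteq> 1" if "prime p" for p
      using nz[OF that] nf[of p] by (metis norm_one not_le)
    show "exp (l p) = inverse (1 - f p)" if p: "prime p" for p
    proof -
      have e1: "exp (- Ln (1 - z p)) = inverse (1 - z p)"
        using exp_minus_Ln_prime[OF p, of s] s by (simp add: z_def)
      have e2: "exp (- Ln (1 - of_nat p powr (- (2 * s)))) = inverse (1 - z p * z p)"
        using exp_minus_Ln_prime[OF p, of "2 * s"] s by (simp add: z_def of_nat_powr_double power2_eq_square)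
      have "z p \<noteq> 1" "z p \<noteq> -1" using nz[OF p] by auto
      then have ne: "1 - z p \<noteq> 0" "1 + z p \<noteq> 0" by (auto simp: add_eq_0_iff)
      have cancel: "inverse (a * b) * a = inverse b" if "a \<noteq> 0" for a b :: complex
        using that by simp
      have "1 - z p * z p = (1 - z p) * (1 + z p)" by (simp add: algebra_simps)
      then have "inverse (1 - z p * z p) * (1 - z p) = inverse (1 + z p)"
        using cancel[OF ne(1)] by metis
      then have "exp (- Ln (1 - of_nat p powr (- (2 * s))) + Ln (1 - z p)) = inverse (1 + z p)"
        unfolding exp_add e2 using ne by simp
      then show ?thesis
        using cases[of p] e1 by (auto simp: l_def f_def simp del: add_uminus_conv_diff uminus_add_conv_diff)
    qed
    have "(\<lambda>p. (if prime p \<and> p \<in> {p. c p = 1} then - Ln (1 - z p) else 0) +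
        ((if prime p \<and> p \<in> {p. c p = -1} then - Ln (1 - of_nat p powr (- (2 * s))) else 0) -
         (if prime p \<and> p \<in> {p. c p = -1} then - Ln (1 - z p) else 0))) sums
        (prime_log {p. c p = 1} s + (prime_log {p. c p = -1} (2 * s) - prime_log {p. c p = -1} s))"
      unfolding z_def by (intro sums_add sums_diff prime_log_sums s s2)
    then show "(\<lambda>p. if prime p then l p else 0) sums
        (prime_log {p. c p = 1} s + (prime_log {p. c p = -1} (2 * s) - prime_log {p. c p = -1} s))"
      by (rule back_subst[of "\<lambda>f. f sums _"]) (auto simp: l_def)
  qed
  then show ?thesis by (simp add: L_series_def f_def z_def del: of_nat_Suc)
qed

text \<open>For constant coefficients 1 no prime has \<open>c p = -1\<close>, so the correction
  terms are sums over the empty set.\<close>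

lemma riemann_zeta_eq_exp:
  assumes "Re s > 1"
  shows "riemann_zeta s = exp (prime_log UNIV s)"
proof -
  have "prime_log {} s = 0" for s by (simp add: prime_log_def)
  then have "L_series (\<lambda>_. 1) s = exp (prime_log UNIV s)" using L_series_eq_exp[OF assms, of "\<lambda>_. 1"] by simp
  then show ?thesis by (simp add: L_series_def riemann_zeta_def)
qed

lemma riemann_zeta_eq_exp_split:
  fixes c :: "nat \<Rightarrow> int"
  assumes s: "Re s > 1" and bound: "\<And>n. \<bar>c n\<bar> \<le> 1"
  shows "riemann_zeta s = exp (prime_log {p. c p = 1} s + prime_log {p. c p = -1} s + prime_log {p. c p = 0} s)"
proof -
  have "c n = 1 \<or> c n = -1 \<or> c n = 0" for n using bound[of n] by (auto simp: abs_le_iff)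
  then have UNIV: "UNIV = ({p. c p = 1} \<union> {p. c p = -1}) \<union> {p. c p = 0}" by auto
  have "prime_log UNIV s = prime_log (({p. c p = 1} \<union> {p. c p = -1}) \<union> {p. c p = 0}) s"
    using UNIV by simp
  also have "\<dots> = prime_log ({p. c p = 1} \<union> {p. c p = -1}) s + prime_log {p. c p = 0} s"
    by (rule prime_log_Un[OF s]) auto
  also have "prime_log ({p. c p = 1} \<union> {p. c p = -1}) s = prime_log {p. c p = 1} s + prime_log {p. c p = -1} s"
    by (rule prime_log_Un[OF s]) auto
  finally show ?thesis by (simp add: riemann_zeta_eq_exp[OF s])
qed

section \<open>Decay of the prime logarithms and the principal branch\<close>

text \<open>The constant is 4/3 * 4 * 1: the factor 4/3 comes from the bound on \<open>Ln\<close>, 4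
  from extracting p^(-2), and 1 bounds the sum of p^(-2) over the primes.\<close>

lemma norm_prime_log_le:
  assumes "Re s \<ge> 2"
  shows "norm (prime_log A s) \<le> 16 / 3 * 2 powr (- Re s)"
proof -
  define C where "C = 16 / 3 * 2 powr (- Re s)"
  \<comment> \<open>A telescoping majorant over all integers from 2 on, with 1 / (n (n - 1)) in
    place of 1 / n^2.\<close>
  define g where "g = (\<lambda>n. if n < 2 then 0 else C * (1 / (real n - 1) - 1 / real n))"
  have "(\<lambda>n. 1 / real (Suc n) - 1 / real (Suc (Suc n))) sums (1 / real (Suc 0) - 0)"
    by (intro telescope_sums' LIMSEQ_Suc lim_1_over_n)
  then have "(\<lambda>n. C * (1 / real (Suc n) - 1 / real (Suc (Suc n)))) sums (C * 1)"
    by (intro sums_mult) simp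
  then have "(\<lambda>n. g (n + 2)) sums C" by (simp add: g_def add_ac)
  then have g: "g sums C" by (subst (asm) sums_zero_iff_shift) (auto simp: g_def)
  have "norm (if prime p \<and> p \<in> A then - Ln (1 - of_nat p powr (-s)) else 0) \<le> g p" for p
  proof (cases "prime p \<and> p \<in> A")
    case True
    then have p: "prime p" "p \<ge> 2" by (auto dest: prime_ge_2_nat)
    have "norm (of_nat p powr (-s) :: complex) \<le> 1 / 4"
      using norm_prime_powr_le[OF p(1) assms] by (simp add: powr_minus_divide)
    from norm_Ln_one_minus_le[OF this]
    have "norm (- Ln (1 - of_nat p powr (-s))) \<le> 4 / 3 * real p powr (- Re s)"
      by (simp add: norm_of_nat_powr)
    \<comment> \<open>One factor p^(-2) is kept for summability; the rest is largest at the prime 2,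
      which gives the decay rate 2^(-Re s).\<close>
    also have "real p powr (- Re s) = real p powr (- (Re s - 2)) * real p powr (- 2)"
      by (simp flip: powr_add)
    also have "\<dots> \<le> 2 powr (- (Re s - 2)) * (1 / (real p - 1) - 1 / real p)"
    proof (intro mult_mono)
      show "real p powr (- (Re s - 2)) \<le> 2 powr (- (Re s - 2))"
        using p assms by (intro powr_mono2') auto
      have "real p powr (- 2) = 1 / (real p * real p)"
        using p by (simp add: powr_minus_divide power2_eq_square)
      also have "\<dots> \<le> 1 / ((real p - 1) * real p)"
        using p by (intro divide_left_mono mult_right_mono) auto
      also have "\<dots> = 1 / (real p - 1) - 1 / real p" using p by (simp add: field_simps)
      finally show "real p powr (- 2) \<le> 1 / (real p - 1) - 1 / real p" .
    qed auto
    also have "2 powr (- (Re s - 2)) = 4 * 2 powr (- Re s)"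
      by (simp add: powr_diff powr_minus_divide)
    finally have "norm (- Ln (1 - of_nat p powr (-s))) \<le> C * (1 / (real p - 1) - 1 / real p)"
      by (simp add: C_def)
    with True p show ?thesis by (simp add: g_def)
  next
    case False
    have "C * (1 / (real p - 1) - 1 / real p) \<ge> 0" if "p \<ge> 2"
      using that by (intro mult_nonneg_nonneg) (auto simp: C_def field_simps)
    then show ?thesis using False by (auto simp: g_def)
  qed
  then have "norm (prime_log A s) \<le> suminf g"
    unfolding prime_log_def using g by (intro norm_suminf_le) (auto simp: sums_iff)
  then show ?thesis using g by (simp add: sums_iff C_def)
qed

text \<open>
  The estimate \<open>\<Sum>\<^sub>p p\<^sup>-\<^sup>2 \<le> 1\<close> keeps the imaginary part within \<open>3 < \<pi>\<close>, so that the principal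
  logarithm is the right branch.
\<close>

lemma Ln_exp_prime_log_combination:
  assumes "Re s \<ge> 2"
  shows "Ln (exp (prime_log A (2 * s) - 2 * prime_log A s)) = prime_log A (2 * s) - 2 * prime_log A s"
proof -
  have "norm (prime_log A s) \<le> 16 / 3 * 2 powr (- Re s)" using assms by (rule norm_prime_log_le)
  also have "\<dots> \<le> 16 / 3 * 2 powr (- 2)" using assms by (intro mult_left_mono powr_mono) auto
  finally have 1: "norm (prime_log A s) \<le> 4 / 3" by (simp add: powr_minus_divide)
  have "norm (prime_log A (2 * s)) \<le> 16 / 3 * 2 powr (- Re (2 * s))" using assms by (intro norm_prime_log_le) simp
  also have "\<dots> \<le> 16 / 3 * 2 powr (- 4)" using assms by (intro mult_left_mono powr_mono) auto
  finally have 2: "norm (prime_log A (2 * s)) \<le> 1 / 3" by (simp add: powr_minus_divide)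
  have "\<bar>Im (prime_log A (2 * s) - 2 * prime_log A s)\<bar> \<le> norm (prime_log A (2 * s) - 2 * prime_log A s)"
    by (rule abs_Im_le_cmod)
  also have "\<dots> \<le> norm (prime_log A (2 * s)) + norm (2 * prime_log A s)" by (rule norm_triangle_ineq4)
  \<comment> \<open>The bounds add up to exactly 1/3 + 2 * 4/3.\<close>
  also have "\<dots> \<le> 3" using 1 2 by (simp add: norm_mult)
  also have "\<dots> < pi" by (rule pi_gt3)
  finally show ?thesis by (intro Ln_exp) auto
qed

section \<open>Telescoping and the error term\<close>

lemma Re_power_2_mult: "Re (2 ^ k * s) = 2 ^ k * Re s"
proof -
  have "2 ^ k * s = of_real (2 ^ k) * s" by simp
  then show ?thesis by (simp only: Re_complex_of_real times_complex.simps Im_complex_of_real)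
qed

text \<open>Once \<open>Ln\<close> and \<open>exp\<close> cancel, the k-th term is the difference of
  \<open>prime_log A (2 ^ Suc k * s) / 2 ^ k\<close> and the same expression at k - 1.\<close>

lemma sum_Ln_telescope:
  assumes "Re s \<ge> 1"
  shows "(\<Sum>k=1..n. 1 / 2 ^ k * Ln (exp (prime_log A (2 * (2 ^ k * s)) - 2 * prime_log A (2 ^ k * s)))) =
    prime_log A (2 ^ Suc n * s) / 2 ^ n - prime_log A (2 * s)"
proof (induction n)
  case (Suc n)
  \<comment> \<open>Every index is at least 1, so Re s \<ge> 1 suffices for the bound 2 under which
    the branch is correct.\<close>
  have "(2::real) ^ Suc n \<ge> 2" by simp
  then have "2 * 1 \<le> (2::real) ^ Suc n * Re s" using assms by (intro mult_mono) auto
  then have "Re (2 ^ Suc n * s) \<ge> 2" unfolding Re_power_2_mult by simp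
  note Ln_exp = Ln_exp_prime_log_combination[OF this, of A]
  have "2 * (2 ^ Suc n * s) = 2 ^ Suc (Suc n) * s" by simp
  then have "1 / 2 ^ Suc n * (prime_log A (2 * (2 ^ Suc n * s)) - 2 * prime_log A (2 ^ Suc n * s)) =
      prime_log A (2 ^ Suc (Suc n) * s) / 2 ^ Suc n - prime_log A (2 ^ Suc n * s) / 2 ^ n"
    by (simp only: diff_divide_distrib right_diff_distrib) simp
  then show ?case unfolding sum.cl_ivl_Suc Ln_exp Suc by simp
qed simp

text \<open>With the sum telescoped, the difference is \<open>exp a * (1 - exp (- b n))\<close>.
  Here \<open>b n\<close> is of order \<open>e n * e n\<close>, and the spare factor
  \<open>e n\<close> turns the O-bound into a little-o bound.\<close>

lemma prime_log_approximation:
  assumes "Re s \<ge> 1"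
  shows "(\<lambda>n. exp (prime_log A (2 * s)) -
     exp (- (\<Sum>k=1..n. 1 / 2 ^ k * Ln (exp (prime_log A (2 * (2 ^ k * s)) - 2 * prime_log A (2 ^ k * s))))))
     \<in> o(\<lambda>n. 1 / 2 ^ (2 ^ n))"
proof -
  define a where "a = prime_log A (2 * s)"
  define b where "b = (\<lambda>n. prime_log A (2 ^ Suc n * s) / 2 ^ n)"
  define e where "e = (\<lambda>n::nat. 1 / 2 ^ (2 ^ n) :: real)"
  \<comment> \<open>The factors are the size of \<open>exp a\<close>, a bound for
    \<open>exp (norm (- b n))\<close>, and the constant in the bound for \<open>b n\<close>.\<close>
  define C where "C = norm (exp a) * exp (16 / 3) * (16 / 3)"
  have e: "0 < e n" "e n \<le> 1" for n by (simp_all add: e_def)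
  have bn: "norm (b n) \<le> 16 / 3 * (e n * e n)" for n
  proof -
    have "(2::real) ^ Suc n * 1 \<le> 2 ^ Suc n * Re s" using assms by (intro mult_left_mono) auto
    then have Re: "Re (2 ^ Suc n * s) \<ge> 2 ^ Suc n" unfolding Re_power_2_mult by simp
    moreover have "(2::real) ^ Suc n \<ge> 2" by simp
    ultimately have "norm (prime_log A (2 ^ Suc n * s)) \<le> 16 / 3 * 2 powr (- Re (2 ^ Suc n * s))"
      by (intro norm_prime_log_le) linarith
    also have "\<dots> \<le> 16 / 3 * 2 powr (- real (2 ^ Suc n))"
      using Re by (intro mult_left_mono powr_mono) auto
    also have "2 powr (- real (2 ^ Suc n)) = 1 / (2::real) ^ (2 ^ Suc n)"
      unfolding powr_minus_divide by (subst powr_realpow) auto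
    also have "\<dots> = e n * e n" by (simp add: e_def power_add[symmetric] mult_2)
    finally have "norm (prime_log A (2 ^ Suc n * s)) \<le> 16 / 3 * (e n * e n)" .
    moreover have "norm (b n) \<le> norm (prime_log A (2 ^ Suc n * s)) / 1"
      unfolding b_def norm_divide by (intro divide_left_mono) (auto simp: norm_power)
    ultimately show ?thesis by simp
  qed
  have bound: "norm ((exp a - exp (- (b n - a))) / (1 / 2 ^ (2 ^ n))) \<le> C * e n" for n
  proof -
    have "e n * e n \<le> 1 * 1" using e by (intro mult_mono) (auto intro: less_imp_le)
    then have "norm (b n) \<le> 16 / 3" using bn[of n] by simp
    then have "exp (norm (- b n)) \<le> exp (16 / 3)" by simp
    then have "exp (norm (- b n)) * norm (b n) \<le> exp (16 / 3) * (16 / 3 * (e n * e n))"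
      using bn by (intro mult_mono) auto
    \<comment> \<open>Taylor's estimate with only the constant term retained.\<close>
    moreover have "norm (exp (- b n) - 1) \<le> exp (norm (- b n)) * norm (b n)"
      using Taylor_exp_field[of "- b n" 0] by simp
    ultimately have "norm (1 - exp (- b n)) \<le> exp (16 / 3) * (16 / 3 * (e n * e n))"
      by (simp add: norm_minus_commute)
    then have "norm (exp a) * norm (1 - exp (- b n)) \<le> norm (exp a) * (exp (16 / 3) * (16 / 3 * (e n * e n)))"
      by (intro mult_left_mono) auto
    moreover have "exp a - exp (- (b n - a)) = exp a * (1 - exp (- b n))"
      by (simp add: algebra_simps flip: exp_add)
    ultimately have "norm (exp a - exp (- (b n - a))) \<le> C * (e n * e n)"
      by (simp add: C_def norm_mult mult_ac)
    then have "norm (exp a - exp (- (b n - a))) / e n \<le> C * e n"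
      using e[of n] by (simp add: divide_le_eq mult_ac)
    then show ?thesis by (simp add: norm_divide norm_mult norm_power e_def)
  qed
  have "e \<longlonglongrightarrow> 0"
  proof (rule tendsto_sandwich[of "\<lambda>_. 0" e _ "\<lambda>n. (1 / 2) ^ n"])
    show "(\<lambda>n. (1 / 2) ^ n) \<longlonglongrightarrow> (0::real)" by (rule LIMSEQ_power_zero) simp
    have "(2::real) ^ n \<le> 2 ^ (2 ^ n)" for n
      by (intro power_increasing) (auto intro: less_imp_le less_exp)
    then have "e n \<le> (1 / 2) ^ n" for n by (simp add: e_def power_one_over divide_left_mono)
    then show "\<forall>\<^sub>F n in sequentially. e n \<le> (1 / 2) ^ n" by simp
    show "\<forall>\<^sub>F n in sequentially. 0 \<le> e n" using e(1) by (simp add: less_imp_le)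
  qed simp
  then have "(\<lambda>n. C * e n) \<longlonglongrightarrow> 0" by (rule tendsto_mult_right_zero)
  then have "(\<lambda>n. (exp a - exp (- (b n - a))) / (1 / 2 ^ (2 ^ n))) \<longlonglongrightarrow> 0"
    by (rule Lim_null_comparison[rotated]) (use bound in auto)
  then have "(\<lambda>n. exp a - exp (- (b n - a))) \<in> o(\<lambda>n. 1 / 2 ^ (2 ^ n))"
    by (intro smalloI_tendsto) auto
  then show ?thesis unfolding sum_Ln_telescope[OF assms] a_def b_def .
qed

section \<open>Exponential form of \<open>q1\<close> and \<open>q2\<close>\<close>

text \<open>Each factor is 1 + z = (1 - z^2) / (1 - z) with z = p^(-s), a quotient of Euler factors
  at \<open>s\<close> and \<open>2 * s\<close>.\<close>

lemma prod_one_plus_prime_powr: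
  assumes s: "Re s > 1" and fin: "finite {p. prime p \<and> P p}"
  shows "(\<Prod>p | prime p \<and> P p. 1 + of_nat p powr (-s)) = exp (prime_log {p. P p} s - prime_log {p. P p} (2 * s))"
proof -
  have "1 + of_nat p powr (-s) = inverse (1 - of_nat p powr (-s)) / inverse (1 - of_nat p powr (- (2 * s)))"
    if "prime p" for p
  proof -
    have "of_nat p powr (-s) \<noteq> (1::complex)" using prime_powr_neq_1[OF that, of s] s by simp
    moreover have "1 - (of_nat p powr (-s))\<^sup>2 = (1 - of_nat p powr (-s)) * (1 + of_nat p powr (-s) :: complex)"
      by (simp add: power2_eq_square algebra_simps)
    ultimately show ?thesis unfolding of_nat_powr_double by (simp add: divide_inverse)
  qed
  then have "(\<Prod>p | prime p \<and> P p. 1 + of_nat p powr (-s)) =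
      (\<Prod>p | prime p \<and> P p. inverse (1 - of_nat p powr (-s)) / inverse (1 - of_nat p powr (- (2 * s))))"
    by (intro prod.cong) auto
  also have "\<dots> = exp (prime_log {p. P p} s) / exp (prime_log {p. P p} (2 * s))"
    unfolding prod_dividef using exp_prime_log_finite[OF s fin] exp_prime_log_finite[of "2 * s", OF _ fin] s by simp
  finally show ?thesis by (simp only: exp_diff)
qed

lemma field_char_eq_0_iff: "prime p \<Longrightarrow> field_char K p = 0 \<longleftrightarrow> p dvd abs_disc K"
  by (simp add: field_char_def abs_disc_def kronecker_prime_eq kronecker_prime_eq_0_iff)

text \<open>Ramified primes divide the discriminant, and a nonzero integer has finitely many
  divisors.\<close>

lemma finite_ramified_primes:
  assumes "quadratic_field K"
  shows "finite {p. prime p \<and> field_char K p = 0}"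
proof -
  have "abs_disc K > 0" using field_disc_nonzero[OF assms] by (simp add: abs_disc_def)
  then have "finite {p. p dvd abs_disc K}" by simp
  then show ?thesis by (rule rev_finite_subset) (auto simp: field_char_eq_0_iff)
qed

lemma L_series_field_char:
  assumes "Re s > 1"
  shows "L_series (field_char K) s = exp (prime_log {p. field_char K p = 1} s +
    (prime_log {p. field_char K p = -1} (2 * s) - prime_log {p. field_char K p = -1} s))"
  by (rule L_series_eq_exp[OF assms])
    (simp_all add: field_char_def kronecker_1 kronecker_mult abs_kronecker_le_1)

lemma riemann_zeta_field_char:
  assumes "Re s > 1"
  shows "riemann_zeta s = exp (prime_log {p. field_char K p = 1} s +
    prime_log {p. field_char K p = -1} s + prime_log {p. field_char K p = 0} s)"
  by (rule riemann_zeta_eq_exp_split[OF assms]) (simp add: field_char_def abs_kronecker_le_1)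

text \<open>Write S, I, R for the logarithms over split, inert and ramified primes at
  \<open>s\<close>, and S', I', R' at \<open>2 * s\<close>. The exponent is (S' + I' + R') - (S + I
  + R) - (S + I' - I) + (R - R') = S' - 2 S.\<close>

lemma q1_eq_exp:
  assumes K: "quadratic_field K" and s: "Re s > 1"
  shows "q1 K s = exp (prime_log {p. field_char K p = 1} (2 * s) - 2 * prime_log {p. field_char K p = 1} s)"
proof -
  have "{p. prime p \<and> p dvd abs_disc K} = {p. prime p \<and> field_char K p = 0}"
    by (auto simp: field_char_eq_0_iff)
  then have prod: "(\<Prod>p | prime p \<and> p dvd abs_disc K. 1 + of_nat p powr (-s)) =
      exp (prime_log {p. field_char K p = 0} s - prime_log {p. field_char K p = 0} (2 * s))"
    using prod_one_plus_prime_powr[OF s finite_ramified_primes[OF K]] by simp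
  have s2: "Re (2 * s) > 1" using s by simp
  show ?thesis
    unfolding q1_def prod riemann_zeta_field_char[OF s, of K] riemann_zeta_field_char[OF s2, of K]
      L_series_field_char[OF s] exp_add[symmetric] exp_diff[symmetric]
    by (simp add: algebra_simps)
qed

text \<open>In the same notation as for \<open>q1\<close> the exponent is (S + I' - I) - (S + I + R)
  + R = I' - 2 I.\<close>

lemma q2_eq_exp:
  assumes K: "quadratic_field K" and s: "Re s > 1"
  shows "q2 K s = exp (prime_log {p. field_char K p = -1} (2 * s) - 2 * prime_log {p. field_char K p = -1} s)"
proof -
  have "{p. prime p \<and> p dvd abs_disc K} = {p. prime p \<and> field_char K p = 0}"
    by (auto simp: field_char_eq_0_iff)
  then have prod: "(\<Prod>p | prime p \<and> p dvd abs_disc K. inverse (1 - of_nat p powr (-s))) =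
      exp (prime_log {p. field_char K p = 0} s)"
    using exp_prime_log_finite[OF s finite_ramified_primes[OF K]] by simp
  show ?thesis
    unfolding q2_def prod riemann_zeta_field_char[OF s, of K] L_series_field_char[OF s]
      exp_add[symmetric] exp_diff[symmetric]
    by (simp add: algebra_simps)
qed

theorem theorem2:
  fixes K :: "'a::field_char_0 set" and s :: complex
  assumes "quadratic_field K"
    and "Re s \<ge> 1"
  shows "(\<lambda>n::nat. p1 K (2 * s) - exp (- (\<Sum>k=1..n. 1 / 2 ^ k * Ln (q1 K (2 ^ k * s)))))
           \<in> o(\<lambda>n. 1 / 2 ^ (2 ^ n)) \<and>
         (\<lambda>n::nat. p2 K (2 * s) - exp (- (\<Sum>k=1..n. 1 / 2 ^ k * Ln (q2 K (2 ^ k * s)))))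
           \<in> o(\<lambda>n. 1 / 2 ^ (2 ^ n))"
proof -
  have s2: "Re (2 * s) > 1" using assms(2) by simp
  \<comment> \<open>The sum starts at k = 1, so the strict inequality holds even on the line Re s =
    1.\<close>
  have Re: "Re (2 ^ k * s) > 1" if "k \<in> {1..n}" for k n :: nat
  proof -
    have "(2::real) ^ k > 1" using that by simp
    moreover have "(2::real) ^ k * 1 \<le> 2 ^ k * Re s" using assms(2) by (intro mult_left_mono) auto
    ultimately show ?thesis unfolding Re_power_2_mult by linarith
  qed
  have p: "p1 K (2 * s) = exp (prime_log {p. field_char K p = 1} (2 * s))"
    "p2 K (2 * s) = exp (prime_log {p. field_char K p = -1} (2 * s))"
    unfolding p1_def p2_def by (rule prime_prodinf_eq_exp_prime_log[OF s2])+
  have q1: "(\<Sum>k=1..n. 1 / 2 ^ k * Ln (q1 K (2 ^ k * s))) = (\<Sum>k=1..n. 1 / 2 ^ k *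
      Ln (exp (prime_log {p. field_char K p = 1} (2 * (2 ^ k * s)) - 2 * prime_log {p. field_char K p = 1} (2 ^ k * s))))" for n
    by (rule sum.cong[OF refl]) (simp only: q1_eq_exp[OF assms(1) Re])
  have q2: "(\<Sum>k=1..n. 1 / 2 ^ k * Ln (q2 K (2 ^ k * s))) = (\<Sum>k=1..n. 1 / 2 ^ k *
      Ln (exp (prime_log {p. field_char K p = -1} (2 * (2 ^ k * s)) - 2 * prime_log {p. field_char K p = -1} (2 ^ k * s))))" for n
    by (rule sum.cong[OF refl]) (simp only: q2_eq_exp[OF assms(1) Re])
  show ?thesis
    unfolding p q1 q2 using prime_log_approximation[OF assms(2)] by blast
qed

end
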